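(* Let $\Gamma$ be a finitely generated group of corank $\ge 2$, i.e. having the free group $F_2$ of rank two as a quotient. Then $\mathcal{FT}_{SO(4,\mathbb C)}(\Gamma)$ is a proper subalgebra of $\mathbb C[X_{SO(4,\mathbb C)}(\Gamma)]$.
   Context: $SO(4,\mathbb C)=\{A\in M(4,\mathbb C): AA^T=I,\ \det A=1\}$. For a reductive algebraic group $G$ over $\mathbb C$ and a group $\Gamma$ generated by $\gamma_1,\dots,\gamma_N$, $Hom(\Gamma,G)$ is viewed as an algebraic subset of $G^N$, $G$ acts on it by conjugation, and $X_G(\Gamma)=Hom(\Gamma,G)//G$ is the categorical quotient, so $\mathbb C[X_G(\Gamma)]=\mathbb C[Hom(\Gamma,G)]^G$. For a (finite-dimensional algebraic) representation $\phi_V:G\to GL(V)$ and $\gamma\in\Gamma$, put $\tau_{\gamma,V}([\rho])=\mathrm{tr}(\phi_V(\rho(\gamma)))$, a regular function on $X_G(\Gamma)$. The full trace algebra $\mathcal{FT}_G(\Gamma)$ is the $\mathbb C$-subalgebra of $\mathbb C[X_G(\Gamma)]$ generated by $\tau_{\gamma,V}$ for all $\gamma\in\Gamma$ and all representations $V$ of $G$. *)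

theory Defs
  imports "Jordan_Normal_Form.Determinant" "HOL-Algebra.Coset" "HOL-Algebra.Generated_Groups"
begin

subsection \<open>Algebras of complex-valued functions\<close>

text \<open>
  Functions on a set \<open>X\<close> are represented extensionally (\<open>undefined\<close> outside \<open>X\<close>), so that
  equality of representatives is equality on \<open>X\<close>.
\<close>

definition function_algebra :: "'x set \<Rightarrow> ('x \<Rightarrow> complex) set \<Rightarrow> bool" where
  "function_algebra X A \<longleftrightarrow>
     A \<subseteq> X \<rightarrow>\<^sub>E UNIV \<and>
     (\<forall>c. (\<lambda>x\<in>X. c) \<in> A) \<and>
     (\<forall>f\<in>A. \<forall>g\<in>A. (\<lambda>x\<in>X. f x + g x) \<in> A \<and> (\<lambda>x\<in>X. f x * g x) \<in> A)"

definition generated_algebra :: "'x set \<Rightarrow> ('x \<Rightarrow> complex) set \<Rightarrow> ('x \<Rightarrow> complex) set" where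
  "generated_algebra X F = function_algebra X hull ((\<lambda>f. restrict f X) ` F)"

lemma function_algebra_generated: "function_algebra X (generated_algebra X F)"
proof -
  let ?G = "(\<lambda>f. restrict f X) ` F"
  have "function_algebra X (X \<rightarrow>\<^sub>E UNIV) \<and> ?G \<subseteq> X \<rightarrow>\<^sub>E UNIV"
    by (auto simp: function_algebra_def)
  then have "function_algebra X hull ?G \<subseteq> X \<rightarrow>\<^sub>E UNIV"
    unfolding hull_def by (intro Inter_lower) simp
  then show ?thesis
    unfolding generated_algebra_def function_algebra_def[of X "_ hull _"]
    by (auto simp: hull_def function_algebra_def)
qed

definition proper_subalgebra ::
    "'x set \<Rightarrow> ('x \<Rightarrow> complex) set \<Rightarrow> ('x \<Rightarrow> complex) set \<Rightarrow> bool" where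
  "proper_subalgebra X A B \<longleftrightarrow> function_algebra X A \<and> function_algebra X B \<and> A \<subset> B"


subsection \<open>Matrix groups and their algebraic representations\<close>

definition matrix_group :: "nat \<Rightarrow> complex mat set \<Rightarrow> complex mat monoid" where
  "matrix_group n S = \<lparr>carrier = S, mult = (*), one = 1\<^sub>m n\<rparr>"

definition GL :: "nat \<Rightarrow> complex mat monoid" where
  "GL n = matrix_group n {A \<in> carrier_mat n n. invertible_mat A}"

definition SO :: "nat \<Rightarrow> complex mat monoid" where
  "SO n = matrix_group n {A \<in> carrier_mat n n. A * A\<^sup>T = 1\<^sub>m n \<and> det A = 1}"

lemma group_SO: "group (SO n)"
proof (rule groupI)
  fix A assume "A \<in> carrier (SO n)"
  then have A: "A \<in> carrier_mat n n" "A * A\<^sup>T = 1\<^sub>m n" "det A = 1"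
    by (auto simp: SO_def matrix_group_def)
  then have "A\<^sup>T * A = 1\<^sub>m n"
    using mat_mult_left_right_inverse[of A n "A\<^sup>T"] by simp
  with A show "\<exists>B\<in>carrier (SO n). B \<otimes>\<^bsub>SO n\<^esub> A = \<one>\<^bsub>SO n\<^esub>"
    by (intro bexI[of _ "A\<^sup>T"]) (auto simp: SO_def matrix_group_def det_transpose)
next
  fix A B assume "A \<in> carrier (SO n)" "B \<in> carrier (SO n)"
  then have A: "A \<in> carrier_mat n n" "A * A\<^sup>T = 1\<^sub>m n" "det A = 1"
    and B: "B \<in> carrier_mat n n" "B * B\<^sup>T = 1\<^sub>m n" "det B = 1"
    by (auto simp: SO_def matrix_group_def)
  have "A * B * (A * B)\<^sup>T = A * B * (B\<^sup>T * A\<^sup>T)"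
    using A B by (simp add: transpose_mult)
  also have "\<dots> = A * (B * B\<^sup>T) * A\<^sup>T"
    using A(1) B(1) by (simp add: assoc_mult_mat[of _ n n _ n _ n])
  also have "\<dots> = 1\<^sub>m n"
    using A B by simp
  finally show "A \<otimes>\<^bsub>SO n\<^esub> B \<in> carrier (SO n)"
    using A B by (auto simp: SO_def matrix_group_def det_mult)
next
  show "\<one>\<^bsub>SO n\<^esub> \<in> carrier (SO n)"
    by (simp add: SO_def matrix_group_def)
next
  fix A B C assume "A \<in> carrier (SO n)" "B \<in> carrier (SO n)" "C \<in> carrier (SO n)"
  then show "A \<otimes>\<^bsub>SO n\<^esub> B \<otimes>\<^bsub>SO n\<^esub> C = A \<otimes>\<^bsub>SO n\<^esub> (B \<otimes>\<^bsub>SO n\<^esub> C)"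
    using assoc_mult_mat[of A n n B n C n] by (simp add: SO_def matrix_group_def)
next
  fix A assume "A \<in> carrier (SO n)"
  then show "\<one>\<^bsub>SO n\<^esub> \<otimes>\<^bsub>SO n\<^esub> A = A"
    by (auto simp add: SO_def matrix_group_def)
qed

text \<open>
  As \<open>SO m\<close> is closed in the space of all matrices, its coordinate ring consists of the
  restrictions of polynomials in the matrix entries.
\<close>

definition regular_functions_SO :: "nat \<Rightarrow> (complex mat \<Rightarrow> complex) set" where
  "regular_functions_SO m =
     generated_algebra (carrier (SO m)) {\<lambda>A. A $$ (i, j) | i j. i < m \<and> j < m}"

text \<open>
  A representation on a space of dimension \<open>n\<close>, written in a basis. Regularity of
  \<open>\<lambda>A. 1 / det (\<phi> A)\<close> need not be required, since it equals \<open>\<lambda>A. det (\<phi> (A\<^sup>T))\<close> on \<open>SO m\<close>.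
\<close>

definition algebraic_rep_SO :: "nat \<Rightarrow> nat \<Rightarrow> (complex mat \<Rightarrow> complex mat) \<Rightarrow> bool" where
  "algebraic_rep_SO m n \<phi> \<longleftrightarrow>
     \<phi> \<in> hom (SO m) (GL n) \<and>
     (\<forall>i<n. \<forall>j<n. (\<lambda>A\<in>carrier (SO m). \<phi> A $$ (i, j)) \<in> regular_functions_SO m)"

definition mat_trace :: "complex mat \<Rightarrow> complex" where
  "mat_trace A = (\<Sum>i<dim_row A. A $$ (i, i))"


subsection \<open>Representation variety, character variety and full trace algebra\<close>

text \<open>
  A homomorphism \<open>\<rho>\<close> stands for the tuple of its values on a generating list \<open>gs\<close>; the ambient
  matrix coordinates of that tuple generate the coordinate ring of the representation variety.
\<close>

definition Hom_SO :: "nat \<Rightarrow> 'a monoid \<Rightarrow> ('a \<Rightarrow> complex mat) set" where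
  "Hom_SO m \<Gamma> = hom \<Gamma> (SO m) \<inter> extensional (carrier \<Gamma>)"

definition coord_ring_Hom_SO ::
    "nat \<Rightarrow> 'a monoid \<Rightarrow> 'a list \<Rightarrow> (('a \<Rightarrow> complex mat) \<Rightarrow> complex) set" where
  "coord_ring_Hom_SO m \<Gamma> gs = generated_algebra (Hom_SO m \<Gamma>)
     {\<lambda>\<rho>. \<rho> \<gamma> $$ (i, j) | \<gamma> i j. \<gamma> \<in> set gs \<and> i < m \<and> j < m}"

definition conj_rep ::
    "nat \<Rightarrow> 'a monoid \<Rightarrow> complex mat \<Rightarrow> ('a \<Rightarrow> complex mat) \<Rightarrow> 'a \<Rightarrow> complex mat" where
  "conj_rep m \<Gamma> g \<rho> = (\<lambda>\<gamma>\<in>carrier \<Gamma>. g \<otimes>\<^bsub>SO m\<^esub> \<rho> \<gamma> \<otimes>\<^bsub>SO m\<^esub> inv\<^bsub>SO m\<^esub> g)"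

text \<open>
  The coordinate ring of the categorical quotient is the ring of invariants, realised as functions
  on the representation variety.
\<close>

definition coord_ring_X_SO ::
    "nat \<Rightarrow> 'a monoid \<Rightarrow> 'a list \<Rightarrow> (('a \<Rightarrow> complex mat) \<Rightarrow> complex) set" where
  "coord_ring_X_SO m \<Gamma> gs = {f \<in> coord_ring_Hom_SO m \<Gamma> gs.
     \<forall>g\<in>carrier (SO m). \<forall>\<rho>\<in>Hom_SO m \<Gamma>. f (conj_rep m \<Gamma> g \<rho>) = f \<rho>}"

definition full_trace_algebra_SO ::
    "nat \<Rightarrow> 'a monoid \<Rightarrow> (('a \<Rightarrow> complex mat) \<Rightarrow> complex) set" where
  "full_trace_algebra_SO m \<Gamma> = generated_algebra (Hom_SO m \<Gamma>)
     {\<lambda>\<rho>. mat_trace (\<phi> (\<rho> \<gamma>)) | \<phi> \<gamma>. \<gamma> \<in> carrier \<Gamma> \<and> (\<exists>n. algebraic_rep_SO m n \<phi>)}"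


subsection \<open>Free groups and corank\<close>

text \<open>
  The free group on \<open>B\<close> as the set of reduced words; the letter \<open>(b, True)\<close> is the generator \<open>b\<close>
  and \<open>(b, False)\<close> its inverse. Prepending the letters of \<open>u\<close> one by one to a reduced word \<open>v\<close>,
  with cancellation, yields the reduced form of \<open>u @ v\<close>.
\<close>

definition inverse_letters :: "'b \<times> bool \<Rightarrow> 'b \<times> bool \<Rightarrow> bool" where
  "inverse_letters x y \<longleftrightarrow> fst x = fst y \<and> snd x \<noteq> snd y"

definition reduced_word :: "('b \<times> bool) list \<Rightarrow> bool" where
  "reduced_word w \<longleftrightarrow> successively (\<lambda>x y. \<not> inverse_letters x y) w"

fun prepend_letter :: "'b \<times> bool \<Rightarrow> ('b \<times> bool) list \<Rightarrow> ('b \<times> bool) list" where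
  "prepend_letter x [] = [x]"
| "prepend_letter x (y # w) = (if inverse_letters x y then w else x # y # w)"

definition free_group :: "'b set \<Rightarrow> ('b \<times> bool) list monoid" where
  "free_group B = \<lparr>carrier = {w. reduced_word w \<and> fst ` set w \<subseteq> B},
     mult = foldr prepend_letter, one = []\<rparr>"

lemma reduced_word_prepend: "reduced_word w \<Longrightarrow> reduced_word (prepend_letter x w)"
  by (cases w) (auto simp: reduced_word_def successively_Cons)

lemma reduced_word_foldr: "reduced_word v \<Longrightarrow> reduced_word (foldr prepend_letter u v)"
  by (induction u) (auto simp: reduced_word_prepend)

lemma prepend_prepend_inverse:
  assumes "reduced_word w" "inverse_letters x y"
  shows "prepend_letter x (prepend_letter y w) = w"
  using assms
  by (cases w; cases "tl w")
     (auto simp: inverse_letters_def reduced_word_def prod_eq_iff)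

lemma foldr_prepend_assoc:
  assumes "reduced_word w"
  shows "foldr prepend_letter (foldr prepend_letter u v) w =
         foldr prepend_letter u (foldr prepend_letter v w)"
proof (induction u)
  case (Cons x u)
  have "foldr prepend_letter (prepend_letter x r) w =
        prepend_letter x (foldr prepend_letter r w)" for r
    using assms
    by (cases r) (auto simp: prepend_prepend_inverse reduced_word_foldr)
  with Cons show ?case by simp
qed simp

lemma foldr_prepend_Nil: "reduced_word w \<Longrightarrow> foldr prepend_letter w [] = w"
proof (induction w)
  case (Cons x w)
  then show ?case by (cases w) (auto simp: reduced_word_def)
qed simp

lemma letters_prepend: "fst ` set (prepend_letter x w) \<subseteq> insert (fst x) (fst ` set w)"
  by (cases w) auto

lemma letters_foldr: "fst ` set (foldr prepend_letter u v) \<subseteq> fst ` set u \<union> fst ` set v"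
proof (induction u)
  case (Cons x u)
  have "fst ` set (foldr prepend_letter (x # u) v)
      \<subseteq> insert (fst x) (fst ` set (foldr prepend_letter u v))"
    using letters_prepend[of x "foldr prepend_letter u v"] by simp
  also have "\<dots> \<subseteq> fst ` set (x # u) \<union> fst ` set v"
    using Cons.IH unfolding list.set image_insert by blast
  finally show ?case .
qed simp

lemma group_free_group: "group (free_group B)"
proof (rule groupI)
  fix u v assume "u \<in> carrier (free_group B)" "v \<in> carrier (free_group B)"
  then have uv: "reduced_word v" "fst ` set u \<subseteq> B" "fst ` set v \<subseteq> B"
    by (auto simp: free_group_def)
  then have "fst ` set (foldr prepend_letter u v) \<subseteq> B"
    using letters_foldr[of u v] by blast
  with uv show "u \<otimes>\<^bsub>free_group B\<^esub> v \<in> carrier (free_group B)"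
    by (simp add: free_group_def reduced_word_foldr)
next
  fix w assume w: "w \<in> carrier (free_group B)"
  let ?flip = "\<lambda>x::'a \<times> bool. (fst x, \<not> snd x)"
  let ?v = "rev (map ?flip w)"
  have cancel: "foldr prepend_letter (rev (map ?flip u)) (foldr prepend_letter u []) = []" for u
  proof (induction u)
    case (Cons x u)
    have "inverse_letters (?flip x) x"
      by (simp add: inverse_letters_def)
    moreover have "reduced_word (foldr prepend_letter u [])"
      by (rule reduced_word_foldr) (simp add: reduced_word_def)
    ultimately show ?case
      using Cons by (simp add: prepend_prepend_inverse)
  qed simp
  have "foldr prepend_letter ?v w = []"
    using w cancel[of w] foldr_prepend_Nil[of w] by (simp add: free_group_def)
  moreover have "reduced_word ?v"
    using w unfolding free_group_def reduced_word_def
    by (auto simp: successively_map successively_rev inverse_letters_def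
        elim!: successively_mono)
  moreover have "fst ` set ?v \<subseteq> B"
    using w by (auto simp: free_group_def image_image)
  ultimately show "\<exists>v\<in>carrier (free_group B). v \<otimes>\<^bsub>free_group B\<^esub> w = \<one>\<^bsub>free_group B\<^esub>"
    by (intro bexI[of _ ?v]) (auto simp: free_group_def)
next
  show "\<one>\<^bsub>free_group B\<^esub> \<in> carrier (free_group B)"
    by (simp add: free_group_def reduced_word_def)
qed (simp_all add: free_group_def foldr_prepend_assoc)

definition corank_at_least_two :: "('a, 'm) monoid_scheme \<Rightarrow> bool" where
  "corank_at_least_two \<Gamma> \<longleftrightarrow> (\<exists>N. N \<lhd> \<Gamma> \<and> (\<Gamma> Mod N) \<cong> free_group {0, 1 :: nat})"

end

theory Submission
  imports Defs "HOL-Computational_Algebra.Polynomial"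
begin

text \<open>
  The unit vectors of the complexified quaternions act on that algebra by
  \<open>q \<mapsto> p * q * qconj r\<close>, and this presents \<open>SO 4\<close> as a quotient of pairs \<open>(p, r)\<close> of unit
  quaternions, where \<open>(p, r)\<close> and \<open>(- p, - r)\<close> act in the same way. A unit quaternion is
  determined up to conjugation by its real part, up to the degenerate case of real part \<open>\<plusminus> 1\<close>, so
  a regular class function on \<open>SO 4\<close> is a polynomial in the real parts \<open>u\<close> and \<open>v\<close> of \<open>p\<close> and \<open>r\<close>,
  invariant under \<open>(u, v) \<mapsto> (- u, - v)\<close>: it is a polynomial in \<open>u\<^sup>2\<close>, \<open>u * v\<close> and \<open>v\<^sup>2\<close>
  (\<open>regular_class_function_rot\<close>). A generator of the full trace algebra can therefore combine the
  left and the right factor of a representation only through their values at one and the same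
  group element.

  The polarised Pfaffian of the images of two group elements \<open>\<alpha>\<close>, \<open>\<beta>\<close> is a conjugation
  invariant that does not have this restriction. If \<open>x, y, z\<close> are the real parts of the left
  factors of the images of \<open>\<alpha>\<close>, \<open>\<beta>\<close>, \<open>\<alpha>\<beta>\<close> and \<open>x', y', z'\<close> those of the right factors, it
  equals \<open>8 * (x * y * z' - x' * y' * z)\<close>.

  The two are told apart by third order jets at the representation that sends two free generators
  to the quaternion units \<open>j\<close>, \<open>i\<close> in both factors, where all six real parts vanish. The two
  curves \<open>\<rho> s\<close> and \<open>\<sigma> s\<close> start at this point. The left factor of \<open>\<rho>\<close> has
  \<open>(x, y, z) = (s, s, 0)\<close>, the right one \<open>(x', y', z') = (0, 0, - s)\<close>, and \<open>\<sigma>\<close> is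
  \<open>\<rho>\<close> with the factors exchanged. For every word in the generators the real parts of the two
  factors are even or odd polynomials in \<open>s\<close> (\<open>parity_of_curve\<close>), and they agree at \<open>s = 0\<close>.
  It follows that along both curves each polynomial in \<open>u\<^sup>2\<close>, \<open>u * v\<close>, \<open>v\<^sup>2\<close> has no linear term,
  and that its constant and its cubic coefficient are the same on the two curves
  (\<open>even_function_matching_jets\<close>). Functions with these properties form an algebra, since a
  product of two of them gets its cubic coefficient only from a constant and a cubic one
  (\<open>function_algebra_jet\<close>); so the whole full trace algebra has them. But the Pfaffian is
  \<open>- 8 * s ^ 3\<close> along \<open>\<rho>\<close> and \<open>8 * s ^ 3\<close> along \<open>\<sigma>\<close>.

  A surjection of \<open>\<Gamma>\<close> onto the free group of rank two pulls these curves back to \<open>\<Gamma>\<close>.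
\<close>

section \<open>Algebras of functions\<close>

lemma restrict_UNIV: "restrict f UNIV = f"
  by (simp add: restrict_def)

lemma function_algebra_const: "function_algebra X A \<Longrightarrow> (\<lambda>x\<in>X. c) \<in> A"
  and function_algebra_add: "function_algebra X A \<Longrightarrow> f \<in> A \<Longrightarrow> g \<in> A \<Longrightarrow> (\<lambda>x\<in>X. f x + g x) \<in> A"
  and function_algebra_mult: "function_algebra X A \<Longrightarrow> f \<in> A \<Longrightarrow> g \<in> A \<Longrightarrow> (\<lambda>x\<in>X. f x * g x) \<in> A"
  by (auto simp: function_algebra_def)

lemma function_algebra_sum:
  assumes "function_algebra X A" "finite I" "\<And>i. i \<in> I \<Longrightarrow> (\<lambda>x\<in>X. f i x) \<in> A"
  shows "(\<lambda>x\<in>X. \<Sum>i\<in>I. f i x) \<in> A"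
  using assms(2,3)
proof (induction I rule: finite_induct)
  case empty
  then show ?case using function_algebra_const[OF assms(1), of 0] by (simp only: sum.empty)
next
  case (insert i I)
  then have "(\<lambda>x\<in>X. (\<lambda>x\<in>X. f i x) x + (\<lambda>x\<in>X. \<Sum>i\<in>I. f i x) x) \<in> A"
    by (intro function_algebra_add[OF assms(1)]) auto
  also have "(\<lambda>x\<in>X. (\<lambda>x\<in>X. f i x) x + (\<lambda>x\<in>X. \<Sum>i\<in>I. f i x) x) = (\<lambda>x\<in>X. \<Sum>i\<in>insert i I. f i x)"
    using insert.hyps by (intro restrict_ext) simp
  finally show ?case .
qed

lemma function_algebra_mult_restrict:
  assumes "function_algebra X A" "(\<lambda>x\<in>X. f x) \<in> A" "(\<lambda>x\<in>X. g x) \<in> A"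
  shows "(\<lambda>x\<in>X. f x * g x) \<in> A"
proof -
  have "(\<lambda>x\<in>X. f x * g x) = (\<lambda>x\<in>X. (\<lambda>x\<in>X. f x) x * (\<lambda>x\<in>X. g x) x)"
    by (rule restrict_ext) simp
  with function_algebra_mult[OF assms] show ?thesis by simp
qed

lemma generated_algebra_minimal:
  assumes "function_algebra X A" "\<And>f. f \<in> F \<Longrightarrow> restrict f X \<in> A"
  shows "generated_algebra X F \<subseteq> A"
  unfolding generated_algebra_def by (rule hull_minimal) (use assms in auto)

lemma generated_algebra_generator: "f \<in> F \<Longrightarrow> restrict f X \<in> generated_algebra X F"
  unfolding generated_algebra_def by (rule hull_inc) auto

text \<open>
  Pulling back along \<open>m\<close> respects constants, sums and products, so only the generators have to be
  looked at. Taking \<open>A\<close> to be polynomial functions of parameters, or the coordinate ring of a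
  representation variety, this is the way in which regularity on \<open>SO m\<close> is used throughout.
\<close>

lemma generated_algebra_pullback:
  assumes A: "function_algebra Y A" and m: "\<And>y. y \<in> Y \<Longrightarrow> m y \<in> X"
    and gen: "\<And>g. g \<in> F \<Longrightarrow> (\<lambda>y\<in>Y. g (m y)) \<in> A" and f: "f \<in> generated_algebra X F"
  shows "(\<lambda>y\<in>Y. f (m y)) \<in> A"
proof -
  let ?B = "{f \<in> X \<rightarrow>\<^sub>E UNIV. (\<lambda>y\<in>Y. f (m y)) \<in> A}"
  have eq: "(\<lambda>y\<in>Y. restrict g X (m y)) = (\<lambda>y\<in>Y. g (m y))" for g :: "_ \<Rightarrow> complex"
    using m by (intro restrict_ext) simp
  have "function_algebra X ?B"
    unfolding function_algebra_def[of X]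
  proof (intro conjI allI ballI)
    show "?B \<subseteq> X \<rightarrow>\<^sub>E UNIV" by auto
  next
    fix c show "(\<lambda>x\<in>X. c) \<in> ?B"
      unfolding mem_Collect_eq eq using function_algebra_const[OF A, of c] by auto
  next
    fix f g assume "f \<in> ?B" "g \<in> ?B"
    then have fg: "(\<lambda>y\<in>Y. f (m y)) \<in> A" "(\<lambda>y\<in>Y. g (m y)) \<in> A" by auto
    have "(\<lambda>y\<in>Y. f (m y) + g (m y)) \<in> A" 
      using function_algebra_add[OF A fg] by (simp cong: restrict_cong)
    then show "(\<lambda>x\<in>X. f x + g x) \<in> ?B"
      unfolding mem_Collect_eq eq by auto
    show "(\<lambda>x\<in>X. f x * g x) \<in> ?B"
      unfolding mem_Collect_eq eq using function_algebra_mult_restrict[OF A fg] by auto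
  qed
  then have "generated_algebra X F \<subseteq> ?B"
  proof (rule generated_algebra_minimal)
    show "restrict g X \<in> ?B" if "g \<in> F" for g
      unfolding mem_Collect_eq eq using gen[OF that] by auto
  qed
  with f show ?thesis by auto
qed

text \<open>
  On the whole type the restrictions disappear, and the closure properties become introduction
  rules that build a function from its subterms.
\<close>

lemma function_algebra_UNIV:
  assumes "function_algebra UNIV A"
  shows "(\<lambda>x. c) \<in> A"
    and "f \<in> A \<Longrightarrow> g \<in> A \<Longrightarrow> (\<lambda>x. f x + g x) \<in> A"
    and "f \<in> A \<Longrightarrow> g \<in> A \<Longrightarrow> (\<lambda>x. f x * g x) \<in> A"
    and "f \<in> A \<Longrightarrow> (\<lambda>x. - f x) \<in> A"
    and "f \<in> A \<Longrightarrow> g \<in> A \<Longrightarrow> (\<lambda>x. f x - g x) \<in> A"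
proof -
  show const: "(\<lambda>x. c) \<in> A" for c
    using function_algebra_const[OF assms, of c] by (simp add: restrict_UNIV)
  show add: "f \<in> A \<Longrightarrow> g \<in> A \<Longrightarrow> (\<lambda>x. f x + g x) \<in> A" for f g
    using function_algebra_add[OF assms, of f g] by (simp add: restrict_UNIV)
  show mult: "f \<in> A \<Longrightarrow> g \<in> A \<Longrightarrow> (\<lambda>x. f x * g x) \<in> A" for f g
    using function_algebra_mult[OF assms, of f g] by (simp add: restrict_UNIV)
  show minus: "f \<in> A \<Longrightarrow> (\<lambda>x. - f x) \<in> A" for f
    using mult[OF const[of "-1"], of f] by simp
  show "f \<in> A \<Longrightarrow> g \<in> A \<Longrightarrow> (\<lambda>x. f x - g x) \<in> A" for f g
    using add[OF _ minus, of f g] by simp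
qed

lemma function_algebra_poly: "function_algebra UNIV (range (poly :: complex poly \<Rightarrow> _))"
  unfolding function_algebra_def
proof (intro conjI allI ballI)
  fix c :: complex show "(\<lambda>x\<in>UNIV. c) \<in> range poly"
    by (auto intro!: image_eqI[of _ _ "[:c:]"])
next
  fix f g :: "complex \<Rightarrow> complex" assume "f \<in> range poly" "g \<in> range poly"
  then obtain p q where pq: "f = poly p" "g = poly q" by auto
  show "(\<lambda>x\<in>UNIV. f x + g x) \<in> range poly"
    by (auto simp: pq intro!: image_eqI[of _ _ "p + q"])
  show "(\<lambda>x\<in>UNIV. f x * g x) \<in> range poly"
    by (auto simp: pq intro!: image_eqI[of _ _ "p * q"])
qed auto

section \<open>Complexified quaternions\<close>

text \<open>
  The quaternion algebra over \<open>\<complex>\<close>, isomorphic to the algebra of \<open>2 \<times> 2\<close> matrices: \<open>qnorm\<close> is the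
  determinant and \<open>qre\<close> half of the trace, so that the quaternions of norm one form \<open>SL 2\<close>.
  In these coordinates the norm is a sum of four squares, hence the linear maps of determinant
  one that preserve it form \<open>SO 4\<close> in its standard form.
\<close>

datatype quat = Quat (qre: complex) (qi: complex) (qj: complex) (qk: complex)

instantiation quat :: ring_1
begin

definition "0 = Quat 0 0 0 0"
definition "1 = Quat 1 0 0 0"
definition "p + q = Quat (qre p + qre q) (qi p + qi q) (qj p + qj q) (qk p + qk q)"
definition "p - q = Quat (qre p - qre q) (qi p - qi q) (qj p - qj q) (qk p - qk q)"
definition "- p = Quat (- qre p) (- qi p) (- qj p) (- qk p)"
definition "p * q = Quat
  (qre p * qre q - qi p * qi q - qj p * qj q - qk p * qk q)
  (qre p * qi q + qi p * qre q + qj p * qk q - qk p * qj q)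
  (qre p * qj q - qi p * qk q + qj p * qre q + qk p * qi q)
  (qre p * qk q + qi p * qj q - qj p * qi q + qk p * qre q)"

lemmas quat_arith = zero_quat_def one_quat_def plus_quat_def minus_quat_def uminus_quat_def
  times_quat_def

instance
  by standard (simp_all add: quat_arith algebra_simps)

end

definition qconj :: "quat \<Rightarrow> quat" where
  "qconj p = Quat (qre p) (- qi p) (- qj p) (- qk p)"

definition qnorm :: "quat \<Rightarrow> complex" where
  "qnorm p = qre p ^ 2 + qi p ^ 2 + qj p ^ 2 + qk p ^ 2"

lemma qnorm_mult: "qnorm (p * q) = qnorm p * qnorm q"
  by (cases p; cases q) (simp add: qnorm_def times_quat_def power2_eq_square algebra_simps)

lemma qnorm_conj [simp]: "qnorm (qconj p) = qnorm p"
  and qnorm_minus [simp]: "qnorm (- p) = qnorm p"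
  and qnorm_one [simp]: "qnorm 1 = 1"
  by (simp_all add: qnorm_def qconj_def quat_arith)

lemma qconj_mult: "qconj (p * q) = qconj q * qconj p"
  by (simp add: qconj_def times_quat_def algebra_simps)

lemma qconj_minus [simp]: "qconj (- p) = - qconj p"
  and qconj_one [simp]: "qconj 1 = 1"
  and qconj_conj [simp]: "qconj (qconj p) = p"
  and qre_minus [simp]: "qre (- p) = - qre p"
  by (simp_all add: qconj_def quat_arith)

lemma mult_qconj: "p * qconj p = Quat (qnorm p) 0 0 0"
  by (simp add: qconj_def times_quat_def qnorm_def power2_eq_square algebra_simps)

lemma unit_mult_qconj: "qnorm p = 1 \<Longrightarrow> p * qconj p = 1"
  and unit_qconj_mult: "qnorm p = 1 \<Longrightarrow> qconj p * p = 1"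
  using mult_qconj[of p] mult_qconj[of "qconj p"] by (simp_all add: one_quat_def)

lemma qre_mult_commute: "qre (p * q) = qre (q * p)"
  by (simp add: times_quat_def algebra_simps)

lemma qre_conjugate: "qnorm g = 1 \<Longrightarrow> qre (g * p * qconj g) = qre p"
  by (metis mult.assoc mult.right_neutral qre_mult_commute unit_qconj_mult)

text \<open>
  A polynomial section of the real part on unit quaternions; in \<open>SL 2\<close> this is a conjugate of the
  companion matrix of \<open>t\<^sup>2 - 2 * c * t + 1\<close>.
\<close>

definition companion :: "complex \<Rightarrow> quat" where
  "companion c = Quat c (\<i> * c) 1 0"

lemma qnorm_companion [simp]: "qnorm (companion c) = 1"
  by (simp add: qnorm_def companion_def power_mult_distrib)

lemma qre_companion [simp]: "qre (companion c) = c"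
  by (simp add: companion_def)

text \<open>
  Since \<open>q\<close> is a root of its characteristic polynomial, \<open>q * q = 2 * qre q * q - 1\<close>. With the same
  real part for \<open>p\<close> this turns the averaging map \<open>x \<mapsto> q * x - x * qconj p\<close> into a source of
  elements that conjugate \<open>p\<close> to \<open>q\<close>, provided they are invertible.
\<close>

lemma intertwiner:
  assumes "qnorm p = 1" "qnorm q = 1" "qre p = qre q"
  defines "g \<equiv> \<lambda>x. q * x - x * qconj p"
  shows "q * g x = g x * p"
proof -
  let ?c = "Quat (2 * qre p) 0 0 0"
  have conj: "qconj r = Quat (2 * qre r) 0 0 0 - r" for r
    by (simp add: qconj_def quat_arith)
  have central: "Quat a 0 0 0 * r = r * Quat a 0 0 0" for a r
    by (simp add: quat_arith mult.commute)
  have "q * (?c - q) = 1"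
    using conj[of q] unit_mult_qconj[OF assms(2)] assms(3) by simp
  then have q2: "q * q = q * ?c - 1"
    by (simp add: algebra_simps)
  have "q * g x = q * q * x - q * x * qconj p"
    by (simp add: g_def algebra_simps)
  also have "\<dots> = (q * ?c - 1) * x - q * x * (?c - p)"
    by (simp only: q2 conj[of p])
  also have "\<dots> = q * (?c * x) - x - q * (x * ?c) + q * x * p"
    by (simp add: algebra_simps)
  also have "\<dots> = q * x * p - x"
    by (simp add: central)
  also have "\<dots> = g x * p"
    by (simp add: g_def algebra_simps unit_qconj_mult assms(1))
  finally show ?thesis .
qed

text \<open>
  The norm of the intertwiner is a quadratic form in \<open>x\<close>. Were it zero at five well chosen
  vectors, the imaginary coordinates of \<open>p\<close> would all vanish. At a vector where it is nonzero the
  intertwiner can be scaled to norm one, as \<open>\<complex>\<close> contains square roots.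
\<close>

lemma nonscalar_conjugate_companion:
  assumes "qnorm p = 1" and nonscalar: "p \<noteq> Quat (qre p) 0 0 0"
  obtains h where "qnorm h = 1" "p = h * companion (qre p) * qconj h"
proof -
  define q where "q = companion (qre p)"
  define g where "g = (\<lambda>x. q * x - x * qconj p)"
  have "\<exists>x. qnorm (g x) \<noteq> 0"
  proof (rule ccontr)
    assume "\<not> ?thesis"
    then have N: "qnorm (g x) = 0" for x by blast
    obtain c p1 p2 p3 where p: "p = Quat c p1 p2 p3" by (cases p)
    have eq: "c^2 + p1^2 + p2^2 + p3^2 = 1"
      using assms(1) by (simp add: qnorm_def p)
    have eq': "p3 * p3 = 1 - c * c - p1 * p1 - p2 * p2"
      using eq by (simp add: power2_eq_square algebra_simps)
    note expand = g_def q_def companion_def p qnorm_def qconj_def quat_arith quat.sel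
    have e: "1 - c^2 + \<i> * c * p1 + p2 = 0" "1 - c^2 - \<i> * c * p1 + p2 = 0"
      "1 - c^2 + \<i> * c * p1 - p2 = 0"
      "1 - c^2 + \<i> * c * p1 - p3 = 0" "1 - c^2 - \<i> * c * p2 + p1 = 0"
    proof -
      \<comment> \<open>For \<open>qnorm x \<noteq> 0\<close> the norm of \<open>g x\<close> is \<open>2 * qnorm x * (n + Q \<bullet> R P)\<close>, where \<open>P\<close>, \<open>Q\<close> are the
         imaginary parts of \<open>p\<close>, \<open>q\<close>, \<open>n = 1 - c\<^sup>2\<close> is the norm of both, and \<open>R\<close> is conjugation by \<open>x\<close>.\<close>
      have "qnorm (g (Quat 1 0 0 0)) = 2 * (1 - c^2 + \<i> * c * p1 + p2)"
        "qnorm (g (Quat 0 0 1 0)) = 2 * (1 - c^2 - \<i> * c * p1 + p2)"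
        "qnorm (g (Quat 0 1 0 0)) = 2 * (1 - c^2 + \<i> * c * p1 - p2)"
        "qnorm (g (Quat 1 1 0 0)) = 4 * (1 - c^2 + \<i> * c * p1 - p3)"
        "qnorm (g (Quat 1 0 0 1)) = 4 * (1 - c^2 - \<i> * c * p2 + p1)"
        by (simp_all add: expand) (simp_all add: power2_eq_square algebra_simps eq')
      then show "1 - c^2 + \<i> * c * p1 + p2 = 0" "1 - c^2 - \<i> * c * p1 + p2 = 0"
        "1 - c^2 + \<i> * c * p1 - p2 = 0"
        "1 - c^2 + \<i> * c * p1 - p3 = 0" "1 - c^2 - \<i> * c * p2 + p1 = 0"
        by (metis N mult_eq_0_iff zero_neq_numeral)+
    qed
    have "p2 = 0" "p3 = 0" "p1 = 0"
      using e by auto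
    then show False
      using nonscalar by (simp add: p)
  qed
  then obtain x where x: "qnorm (g x) \<noteq> 0" by blast
  define k where "k = Quat (1 / csqrt (qnorm (g x))) 0 0 0"
  define h where "h = g x * k"
  have "qnorm k * qnorm (g x) = 1"
    using x by (simp add: k_def qnorm_def power_divide)
  then have h: "qnorm h = 1"
    by (simp add: h_def qnorm_mult mult.commute)
  have "q * g x = g x * p"
    unfolding g_def by (rule intertwiner) (simp_all add: q_def assms)
  moreover have "k * p = p * k"
    by (simp add: k_def quat_arith mult.commute)
  ultimately have "q * h = h * p"
    unfolding h_def by (metis mult.assoc)
  then have "p = qconj h * q * qconj (qconj h)"
    by (metis h mult.assoc mult.left_neutral qconj_conj unit_qconj_mult)
  with h show ?thesis
    by (intro that[of "qconj h"]) (simp_all add: q_def)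
qed

section \<open>Pairs of unit quaternions as rotations\<close>

text \<open>
  The sum over all permutations of four indices with signs, written out so that determinants and
  Pfaffians of explicit matrices can be evaluated by rewriting.
\<close>

definition alternating_sum :: "(nat \<Rightarrow> nat \<Rightarrow> nat \<Rightarrow> nat \<Rightarrow> complex) \<Rightarrow> complex" where
  "alternating_sum f =
    f 0 1 2 3 - f 0 1 3 2 - f 0 2 1 3 + f 0 2 3 1 + f 0 3 1 2 - f 0 3 2 1
    - f 1 0 2 3 + f 1 0 3 2 + f 1 2 0 3 - f 1 2 3 0 - f 1 3 0 2 + f 1 3 2 0
    + f 2 0 1 3 - f 2 0 3 1 - f 2 1 0 3 + f 2 1 3 0 + f 2 3 0 1 - f 2 3 1 0
    - f 3 0 1 2 + f 3 0 2 1 + f 3 1 0 2 - f 3 1 2 0 - f 3 2 0 1 + f 3 2 1 0"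

lemma alternating_sum_permutations:
  "alternating_sum f = (\<Sum>p | p permutes {0..<4}. signof p * f (p 0) (p 1) (p 2) (p 3))"
proof -
  have set4: "{0..<4::nat} = {0, 1, 2, 3}"
    by auto
  have notin: "finite {1::nat, 2, 3}" "0 \<notin> {1::nat, 2, 3}" "finite {2::nat, 3}" "1 \<notin> {2::nat, 3}"
    "finite {3::nat}" "2 \<notin> {3::nat}"
    by auto
  show ?thesis
    unfolding alternating_sum_def set4
    unfolding sum_over_permutations_insert[OF notin(1,2)]
    unfolding sum_over_permutations_insert[OF notin(3,4)]
    unfolding sum_over_permutations_insert[OF notin(5,6)]
    unfolding permutes_sing
    by (simp add: sign_swap_id permutation_swap_id sign_compose sign_id swap_id_eq
        permutation_compose transpose_def)
qed

definition qcoord :: "quat \<Rightarrow> nat \<Rightarrow> complex" where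
  "qcoord q i = [qre q, qi q, qj q, qk q] ! i"

definition qbasis :: "nat \<Rightarrow> quat" where
  "qbasis i = [Quat 1 0 0 0, Quat 0 1 0 0, Quat 0 0 1 0, Quat 0 0 0 1] ! i"

text \<open>
  The matrix of \<open>q \<mapsto> p * q * qconj r\<close> in the basis \<open>1, i, j, k\<close>.
\<close>

definition rot :: "quat \<Rightarrow> quat \<Rightarrow> complex mat" where
  "rot p r = mat 4 4 (\<lambda>(i, j). qcoord (p * qbasis j * qconj r) i)"

lemma less_four: "(i::nat) < 4 \<longleftrightarrow> i = 0 \<or> i = 1 \<or> i = 2 \<or> i = 3"
  by auto

lemma rot_carrier [simp]: "rot p r \<in> carrier_mat 4 4"
  and rot_dim [simp]: "dim_row (rot p r) = 4" "dim_col (rot p r) = 4"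
  by (simp_all add: rot_def)

lemma rot_index [simp]: "i < 4 \<Longrightarrow> j < 4 \<Longrightarrow> rot p r $$ (i, j) = qcoord (p * qbasis j * qconj r) i"
  by (simp add: rot_def)

lemma sum_four: "(\<Sum>k = 0..<4. h k) = h 0 + h 1 + h 2 + h (3::nat)" for h :: "nat \<Rightarrow> complex"
  by (simp add: numeral_eq_Suc)

text \<open>
  Linearity of \<open>x \<mapsto> p * x * r\<close>, in the form needed to read a composition of two such maps as a
  matrix product.
\<close>

lemma qcoord_expand:
  "i < 4 \<Longrightarrow> qcoord (p * x * r) i = (\<Sum>k = 0..<4. qcoord x k * qcoord (p * qbasis k * r) i)"
  unfolding less_four
  by (elim disjE)
     (simp_all add: sum_four qcoord_def qbasis_def times_quat_def algebra_simps numeral_eq_Suc)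

lemma rot_mult: "rot p r * rot p' r' = rot (p * p') (r * r')"
proof (rule eq_matI)
  fix i j assume "i < dim_row (rot (p * p') (r * r'))" "j < dim_col (rot (p * p') (r * r'))"
  then have ij: "i < 4" "j < 4" by auto
  have "(rot p r * rot p' r') $$ (i, j) =
      (\<Sum>k = 0..<4. qcoord (p' * qbasis j * qconj r') k * qcoord (p * qbasis k * qconj r) i)"
    using ij by (simp add: scalar_prod_def mult.commute)
  also have "\<dots> = qcoord (p * (p' * qbasis j * qconj r') * qconj r) i"
    by (rule qcoord_expand[symmetric]) (rule ij)
  finally show "(rot p r * rot p' r') $$ (i, j) = rot (p * p') (r * r') $$ (i, j)"
    using ij by (simp add: qconj_mult mult.assoc)
qed auto

lemma rot_one: "rot 1 1 = 1\<^sub>m 4"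
  by (rule eq_matI) (auto simp: less_four qcoord_def qbasis_def quat_arith qconj_def)

text \<open>
  The adjoint of multiplication by \<open>p\<close> with respect to the bilinear form of the norm is
  multiplication by \<open>qconj p\<close>.
\<close>

lemma rot_transpose: "(rot p r)\<^sup>T = rot (qconj p) (qconj r)"
proof (rule eq_matI)
  have "qcoord (p * qbasis i * qconj r) j = qcoord (qconj p * qbasis j * r) i" if "i < 4" "j < 4" for i j
    using that unfolding less_four
    by (elim disjE) (simp_all add: qcoord_def qbasis_def times_quat_def qconj_def algebra_simps numeral_eq_Suc)
  then show "i < dim_row (rot (qconj p) (qconj r)) \<Longrightarrow> j < dim_col (rot (qconj p) (qconj r)) \<Longrightarrow>
     (rot p r)\<^sup>T $$ (i, j) = rot (qconj p) (qconj r) $$ (i, j)" for i j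
    by simp
qed auto

lemma det_four:
  assumes "M \<in> carrier_mat 4 4"
  shows "det M = alternating_sum (\<lambda>a b c d. M $$ (0, a) * M $$ (1, b) * M $$ (2, c) * M $$ (3, d))"
  unfolding det_def'[OF assms] alternating_sum_permutations by (simp add: numeral_eq_Suc mult.assoc)

lemma rot_left_entries:
  "i < 4 \<Longrightarrow> j < 4 \<Longrightarrow> rot (Quat a b c d) 1 $$ (i, j) =
    [[a, - b, - c, - d], [b, a, - d, c], [c, d, a, - b], [d, - c, b, a]] ! i ! j"
  unfolding less_four
  by (elim disjE) (simp_all add: qcoord_def qbasis_def quat_arith qconj_def numeral_eq_Suc)

lemma rot_right_entries:
  "i < 4 \<Longrightarrow> j < 4 \<Longrightarrow> rot 1 (Quat a b c d) $$ (i, j) =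
    [[a, b, c, d], [- b, a, - d, c], [- c, d, a, - b], [- d, - c, b, a]] ! i ! j"
  unfolding less_four
  by (elim disjE) (simp_all add: qcoord_def qbasis_def quat_arith qconj_def numeral_eq_Suc)

text \<open>
  Orthogonality only gives determinant \<open>\<plusminus> 1\<close> for unit quaternions; the sign needs the determinant
  itself. The left and the right multiplication are treated apart because each has entries that
  are single coordinates.
\<close>

lemma det_rot_left: "det (rot p 1) = qnorm p ^ 2"
  unfolding det_four[OF rot_carrier] alternating_sum_def
  by (cases p) (simp add: rot_left_entries qnorm_def del: rot_index,
      simp add: power2_eq_square, simp only: ring_distribs, simp only: mult_ac, simp)

lemma det_rot_right: "det (rot 1 r) = qnorm r ^ 2"
  unfolding det_four[OF rot_carrier] alternating_sum_def
  by (cases r) (simp add: rot_right_entries qnorm_def del: rot_index,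
      simp add: power2_eq_square, simp only: ring_distribs, simp only: mult_ac, simp)

lemma det_rot: "det (rot p r) = qnorm p ^ 2 * qnorm r ^ 2"
  using det_mult[of "rot p 1" 4 "rot 1 r"] by (simp add: rot_mult det_rot_left det_rot_right)

lemma rot_SO:
  assumes "qnorm p = 1" "qnorm r = 1"
  shows "rot p r \<in> carrier (SO 4)"
  using assms by (simp add: SO_def matrix_group_def rot_transpose rot_mult rot_one unit_mult_qconj det_rot)

lemma rot_minus: "rot (- p) (- r) = rot p r"
  by (simp add: rot_def)

section \<open>The polarised Pfaffian\<close>

text \<open>
  On skew-symmetric matrices this is, up to a factor, the bilinear form whose quadratic form is the
  Pfaffian. It sees only the skew-symmetric parts of \<open>A\<close> and \<open>B\<close>, so orthogonal matrices can be
  inserted directly.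
\<close>

definition polar_pfaffian :: "complex mat \<Rightarrow> complex mat \<Rightarrow> complex" where
  "polar_pfaffian A B = alternating_sum (\<lambda>a b c d. A $$ (a, b) * B $$ (c, d))"

lemma transpose_conj_index:
  fixes g A :: "complex mat"
  assumes "g \<in> carrier_mat 4 4" "A \<in> carrier_mat 4 4" "i < 4" "j < 4"
  shows "(g * A * g\<^sup>T) $$ (i, j) = (\<Sum>k<4. \<Sum>l<4. A $$ (k, l) * g $$ (i, k) * g $$ (j, l))"
proof -
  have "(g * A * g\<^sup>T) $$ (i, j) = (\<Sum>l<4. (\<Sum>k<4. g $$ (i, k) * A $$ (k, l)) * g $$ (j, l))"
    using assms by (simp add: scalar_prod_def atLeast0LessThan sum_distrib_left sum_distrib_right mult.assoc)
      (rule sum.swap)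
  also have "\<dots> = (\<Sum>k<4. \<Sum>l<4. A $$ (k, l) * g $$ (i, k) * g $$ (j, l))"
    by (subst sum.swap) (simp add: sum_distrib_left sum_distrib_right mult_ac)
  finally show ?thesis .
qed

text \<open>
  Both sides are determinants: the matrix formed by the columns \<open>idx 0\<close>, ..., \<open>idx 3\<close> of \<open>g\<close> is
  the product of \<open>g\<close> with the matrix formed by the same columns of the identity.
\<close>

lemma alternating_sum_columns:
  fixes g :: "complex mat"
    and idx :: "nat \<Rightarrow> nat"
  assumes "g \<in> carrier_mat 4 4" "\<And>i. i < 4 \<Longrightarrow> idx i < 4"
  shows "alternating_sum (\<lambda>a b c d.
      g $$ (a, idx 0) * g $$ (b, idx 1) * g $$ (c, idx 2) * g $$ (d, idx 3)) =
    det g * alternating_sum (\<lambda>a b c d.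
      1\<^sub>m 4 $$ (a, idx 0) * 1\<^sub>m 4 $$ (b, idx 1) * 1\<^sub>m 4 $$ (c, idx 2) * 1\<^sub>m 4 $$ (d, idx 3))"
proof -
  have det: "det M = alternating_sum (\<lambda>a b c d. M $$ (a, 0) * M $$ (b, 1) * M $$ (c, 2) * M $$ (d, 3))"
    if "M \<in> carrier_mat 4 4" for M :: "complex mat"
    unfolding det_col[OF that] alternating_sum_permutations by (simp add: numeral_eq_Suc mult.assoc)
  define E where "E = mat 4 4 (\<lambda>(i, j). 1\<^sub>m 4 $$ (i, idx j) :: complex)"
  have E: "E \<in> carrier_mat 4 4" by (simp add: E_def)
  have gE: "(g * E) $$ (i, j) = g $$ (i, idx j)" if "i < 4" "j < 4" for i j
  proof -
    have "col E j = col (1\<^sub>m 4) (idx j)"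
      using that assms(2) by (intro eq_vecI) (simp_all add: E_def)
    then have "(g * E) $$ (i, j) = (g * 1\<^sub>m 4) $$ (i, idx j)"
      using that assms E by simp
    then show ?thesis
      using assms(1) by simp
  qed
  have "det (g * E) = det g * det E"
    using assms(1) E by (rule det_mult)
  moreover have "det (g * E) = alternating_sum (\<lambda>a b c d.
      g $$ (a, idx 0) * g $$ (b, idx 1) * g $$ (c, idx 2) * g $$ (d, idx 3))"
    using assms(1) E by (subst det) (simp_all add: alternating_sum_def gE del: index_mult_mat(1))
  moreover have "det E = alternating_sum (\<lambda>a b c d.
      1\<^sub>m 4 $$ (a, idx 0) * 1\<^sub>m 4 $$ (b, idx 1) * 1\<^sub>m 4 $$ (c, idx 2) * 1\<^sub>m 4 $$ (d, idx 3))"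
    by (subst det[OF E]) (simp add: alternating_sum_def E_def)
  ultimately show ?thesis by simp
qed

text \<open>
  After expansion of \<open>g * A * g\<^sup>T\<close> and \<open>g * B * g\<^sup>T\<close>, the Pfaffian is a combination of determinants
  of columns of \<open>g\<close>, with coefficients that do not depend on \<open>g\<close>. Each of them is \<open>det g\<close> times
  its value for \<open>g = 1\<close>.
\<close>

lemma polar_pfaffian_conjugate:
  assumes g: "g \<in> carrier_mat 4 4" and A: "A \<in> carrier_mat 4 4" and B: "B \<in> carrier_mat 4 4"
  shows "polar_pfaffian (g * A * g\<^sup>T) (g * B * g\<^sup>T) = det g * polar_pfaffian A B"
proof -
  have sum: "alternating_sum (\<lambda>a b c d. \<Sum>i\<in>I. f i a b c d) =
      (\<Sum>i\<in>I. alternating_sum (f i))" for I :: "nat set" and f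
    unfolding alternating_sum_permutations
    by (subst sum.swap) (simp add: sum_distrib_left)
  have scale: "alternating_sum (\<lambda>a b c d. x * f a b c d) = x * alternating_sum f" for x f
    unfolding alternating_sum_permutations by (simp add: sum_distrib_left mult_ac)
  have expand: "(\<Sum>k<4. \<Sum>l<4. X k l) * (\<Sum>m<4. \<Sum>n<4. Y m n) =
      (\<Sum>k<4. \<Sum>l<4. \<Sum>m<4. \<Sum>n<4. X k l * Y m n)" for X Y :: "nat \<Rightarrow> nat \<Rightarrow> complex"
    by (simp only: sum_distrib_right) (simp only: sum_distrib_left)
  have mult: "polar_pfaffian (g * A * g\<^sup>T) (g * B * g\<^sup>T) =
      (\<Sum>k<4. \<Sum>l<4. \<Sum>m<4. \<Sum>n<4. A $$ (k, l) * B $$ (m, n) *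
        alternating_sum (\<lambda>a b c d. g $$ (a, k) * g $$ (b, l) * g $$ (c, m) * g $$ (d, n)))"
    if g: "g \<in> carrier_mat 4 4" for g
  proof -
    define S where "S = (\<lambda>a b c d. \<Sum>k<4. \<Sum>l<4. \<Sum>m<4. \<Sum>n<4. A $$ (k, l) * B $$ (m, n) *
      (g $$ (a, k) * g $$ (b, l) * g $$ (c, m) * g $$ (d, n)))"
    have "(g * A * g\<^sup>T) $$ (a, b) * (g * B * g\<^sup>T) $$ (c, d) = S a b c d"
      if "a < 4" "b < 4" "c < 4" "d < 4" for a b c d
      using that unfolding S_def
      by (simp only: transpose_conj_index[OF g] A B expand) (simp only: mult_ac)
    then have "polar_pfaffian (g * A * g\<^sup>T) (g * B * g\<^sup>T) = alternating_sum S"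
      by (simp add: polar_pfaffian_def alternating_sum_def del: index_mult_mat)
    then show ?thesis
      by (simp only: S_def sum scale)
  qed
  have "polar_pfaffian (g * A * g\<^sup>T) (g * B * g\<^sup>T) =
      (\<Sum>k<4. \<Sum>l<4. \<Sum>m<4. \<Sum>n<4. A $$ (k, l) * B $$ (m, n) * (det g *
        alternating_sum (\<lambda>a b c d.
          1\<^sub>m 4 $$ (a, k) * 1\<^sub>m 4 $$ (b, l) * 1\<^sub>m 4 $$ (c, m) * 1\<^sub>m 4 $$ (d, n))))"
    unfolding mult[OF g]
  proof (intro sum.cong refl arg_cong2[of _ _ _ _ "(*)"])
    fix k l m n assume "k \<in> {..<4::nat}" "l \<in> {..<4::nat}" "m \<in> {..<4::nat}" "n \<in> {..<4::nat}"
    then show "alternating_sum (\<lambda>a b c d. g $$ (a, k) * g $$ (b, l) * g $$ (c, m) * g $$ (d, n)) =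
        det g * alternating_sum (\<lambda>a b c d.
          1\<^sub>m 4 $$ (a, k) * 1\<^sub>m 4 $$ (b, l) * 1\<^sub>m 4 $$ (c, m) * 1\<^sub>m 4 $$ (d, n))"
      using alternating_sum_columns[OF g, of "\<lambda>i. if i = 0 then k else if i = 1 then l else if i = 2 then m else n"]
      by simp
  qed
  also have "\<dots> = det g * polar_pfaffian A B"
  proof -
    \<comment> \<open>The same expansion, read backwards at the identity matrix.\<close>
    have "1\<^sub>m 4 * M * (1\<^sub>m 4)\<^sup>T = M" if "M \<in> carrier_mat 4 4" for M :: "complex mat"
      using that by simp
    then have "polar_pfaffian A B = polar_pfaffian (1\<^sub>m 4 * A * (1\<^sub>m 4)\<^sup>T) (1\<^sub>m 4 * B * (1\<^sub>m 4)\<^sup>T)"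
      using A B by simp
    then show ?thesis
      unfolding mult[OF one_carrier_mat] by (simp only: sum_distrib_left mult_ac)
  qed
  finally show ?thesis .
qed

section \<open>Regular class functions on SO(4)\<close>

definition quat_coords_in :: "('y \<Rightarrow> complex) set \<Rightarrow> ('y \<Rightarrow> quat) \<Rightarrow> bool" where
  "quat_coords_in A p \<longleftrightarrow> (\<lambda>y. qre (p y)) \<in> A \<and> (\<lambda>y. qi (p y)) \<in> A \<and>
     (\<lambda>y. qj (p y)) \<in> A \<and> (\<lambda>y. qk (p y)) \<in> A"

lemma quat_coords_in_mult:
  assumes "function_algebra UNIV A" "quat_coords_in A p" "quat_coords_in A q"
  shows "quat_coords_in A (\<lambda>y. p y * q y)"
  using assms(2,3) unfolding quat_coords_in_def times_quat_def quat.sel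
  by (intro conjI function_algebra_UNIV(2,3,5)[OF assms(1)]) auto

lemma quat_coords_in_const: "function_algebra UNIV A \<Longrightarrow> quat_coords_in A (\<lambda>y. q)"
  by (simp add: quat_coords_in_def function_algebra_UNIV(1))

lemma quat_coords_in_conj:
  assumes "function_algebra UNIV A" "quat_coords_in A p"
  shows "quat_coords_in A (\<lambda>y. qconj (p y))"
  using assms(2) unfolding quat_coords_in_def qconj_def quat.sel
  by (auto intro: function_algebra_UNIV(4)[OF assms(1)])

text \<open>
  A family of unit quaternions whose coordinates lie in an algebra of functions gives a family of
  rotations with the same property; regular functions on \<open>SO 4\<close> are polynomials in the entries.
\<close>

lemma regular_function_rot:
  assumes f: "f \<in> regular_functions_SO 4" and A: "function_algebra UNIV A"
    and p: "quat_coords_in A p" "\<And>y. qnorm (p y) = 1"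
    and r: "quat_coords_in A r" "\<And>y. qnorm (r y) = 1"
  shows "(\<lambda>y. f (rot (p y) (r y))) \<in> A"
proof -
  have entry: "(\<lambda>y. rot (p y) (r y) $$ (i, j)) \<in> A" if "i < 4" "j < 4" for i j
  proof -
    have "quat_coords_in A (\<lambda>y. p y * qbasis j * qconj (r y))"
      by (intro quat_coords_in_mult quat_coords_in_const quat_coords_in_conj A p r)
    then show ?thesis
      using that(1) unfolding less_four rot_index[OF that]
      by (elim disjE) (simp_all add: quat_coords_in_def qcoord_def numeral_eq_Suc)
  qed
  have "(\<lambda>y\<in>UNIV. f (rot (p y) (r y))) \<in> A"
    by (rule generated_algebra_pullback[OF A _ _ f[unfolded regular_functions_SO_def]])
      (auto simp: rot_SO p r entry restrict_UNIV simp del: rot_index)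
  then show ?thesis by (simp add: restrict_UNIV)
qed

text \<open>
  The polynomial functions of two variables that are unchanged under \<open>(u, v) \<mapsto> (- u, - v)\<close>, given
  by generators of that ring of invariants.
\<close>

definition even_functions :: "(complex \<times> complex \<Rightarrow> complex) set" where
  "even_functions = generated_algebra UNIV
     {\<lambda>z. fst z * fst z, \<lambda>z. fst z * snd z, \<lambda>z. snd z * snd z}"

lemma function_algebra_even: "function_algebra UNIV even_functions"
  unfolding even_functions_def by (rule function_algebra_generated)

lemma even_functions_minus: "E \<in> even_functions \<Longrightarrow> E (- u, - v) = E (u, v)"
proof -
  assume "E \<in> even_functions"
  moreover have "function_algebra UNIV {E. \<forall>u v. E (- u, - v :: complex) = E (u, v :: complex)}"
    by (auto simp: function_algebra_def)
  then have "even_functions \<subseteq> {E. \<forall>u v. E (- u, - v) = E (u, v)}"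
    unfolding even_functions_def by (rule generated_algebra_minimal) auto
  ultimately show ?thesis by auto
qed

text \<open>
  The functions of the stated form are closed under products, since a product of two of the
  variables is a generator of the even functions. So they make up all polynomials.
\<close>

lemma polynomial_even_odd:
  assumes "P \<in> generated_algebra UNIV {fst, snd :: complex \<times> complex \<Rightarrow> complex}"
  obtains E E1 E2 where "E \<in> even_functions" "E1 \<in> even_functions" "E2 \<in> even_functions"
    "\<And>z. P z = E z + fst z * E1 z + snd z * E2 z"
proof -
  let ?B = "{P. \<exists>E\<in>even_functions. \<exists>E1\<in>even_functions. \<exists>E2\<in>even_functions.
    \<forall>z. P z = E z + fst z * E1 z + snd z * E2 z}"
  note closed = function_algebra_UNIV[OF function_algebra_even]
  have gens: "(\<lambda>z. fst z * fst z) \<in> even_functions" "(\<lambda>z. fst z * snd z) \<in> even_functions"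
    "(\<lambda>z. snd z * snd z) \<in> even_functions"
    unfolding even_functions_def
    using generated_algebra_generator[of _ "{\<lambda>z. fst z * fst z, \<lambda>z. fst z * snd z, \<lambda>z. snd z * snd z}" "UNIV :: (complex \<times> complex) set"]
    by (simp_all add: restrict_UNIV)
  have "function_algebra UNIV ?B"
    unfolding function_algebra_def
  proof (intro conjI allI ballI)
    fix c show "(\<lambda>x\<in>UNIV. c) \<in> ?B"
      unfolding mem_Collect_eq restrict_UNIV
      by (rule bexI[OF bexI[OF bexI[OF _ closed(1)[of 0]] closed(1)[of 0]] closed(1)[of c]]) simp
  next
    fix P Q assume "P \<in> ?B" "Q \<in> ?B"
    then obtain E E1 E2 F F1 F2 where
      mem: "E \<in> even_functions" "E1 \<in> even_functions" "E2 \<in> even_functions"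
        "F \<in> even_functions" "F1 \<in> even_functions" "F2 \<in> even_functions"
      and P: "\<And>z. P z = E z + fst z * E1 z + snd z * E2 z"
      and Q: "\<And>z. Q z = F z + fst z * F1 z + snd z * F2 z" by blast
    show "(\<lambda>x\<in>UNIV. P x + Q x) \<in> ?B"
      unfolding mem_Collect_eq restrict_UNIV P Q
      by (rule bexI[OF bexI[OF bexI[OF _ closed(2)[OF mem(3,6)]] closed(2)[OF mem(2,5)]]
            closed(2)[OF mem(1,4)]]) (simp add: algebra_simps)
    have "(\<lambda>z. E z * F z + (fst z * fst z) * (E1 z * F1 z)
        + (fst z * snd z) * (E1 z * F2 z + E2 z * F1 z) + (snd z * snd z) * (E2 z * F2 z)) \<in> even_functions"
      by (intro closed(2,3) gens mem)
    moreover have "(\<lambda>z. E z * F1 z + E1 z * F z) \<in> even_functions"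
      "(\<lambda>z. E z * F2 z + E2 z * F z) \<in> even_functions"
      by (intro closed(2,3) mem)+
    ultimately show "(\<lambda>x\<in>UNIV. P x * Q x) \<in> ?B"
      unfolding mem_Collect_eq restrict_UNIV P Q
      by (elim bexI[rotated]) (simp add: algebra_simps)
  qed auto
  then have "generated_algebra UNIV {fst, snd} \<subseteq> ?B"
  proof (rule generated_algebra_minimal)
    fix f :: "complex \<times> complex \<Rightarrow> complex" assume "f \<in> {fst, snd}"
    then show "restrict f UNIV \<in> ?B"
      unfolding mem_Collect_eq restrict_UNIV
    proof (elim insertE emptyE)
      assume "f = fst"
      then show "\<exists>E\<in>even_functions. \<exists>E1\<in>even_functions. \<exists>E2\<in>even_functions.
          \<forall>z. f z = E z + fst z * E1 z + snd z * E2 z"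
        by (intro bexI[OF bexI[OF bexI[OF _ closed(1)[of 0]] closed(1)[of 1]] closed(1)[of 0]]) simp
    next
      assume "f = snd"
      then show "\<exists>E\<in>even_functions. \<exists>E1\<in>even_functions. \<exists>E2\<in>even_functions.
          \<forall>z. f z = E z + fst z * E1 z + snd z * E2 z"
        by (intro bexI[OF bexI[OF bexI[OF _ closed(1)[of 1]] closed(1)[of 0]] closed(1)[of 0]]) simp
    qed
  qed
  with assms show ?thesis using that by blast
qed

text \<open>
  Quaternions other than \<open>1\<close> and \<open>- 1\<close> are conjugate to the companion of their real part. The two
  exceptions are reached as limits: \<open>c + e * (i + \<i> * j)\<close> has norm one and real part \<open>c\<close> for all
  \<open>e\<close>, and the function is constant on this line away from \<open>e = 0\<close>, hence constant because it is
  polynomial there.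
\<close>

lemma class_function_companion:
  fixes F :: "quat \<Rightarrow> complex"
  assumes invariant: "\<And>g p. qnorm g = 1 \<Longrightarrow> qnorm p = 1 \<Longrightarrow> F (g * p * qconj g) = F p"
    and poly: "\<And>c. c * c = 1 \<Longrightarrow> (\<lambda>e. F (Quat c e (\<i> * e) 0)) \<in> range poly"
    and p: "qnorm p = 1"
  shows "F p = F (companion (qre p))"
proof -
  have nonscalar: "F p = F (companion (qre p))"
    if p: "qnorm p = 1" "p \<noteq> Quat (qre p) 0 0 0" for p
    using nonscalar_conjugate_companion[OF p] invariant by (metis qnorm_companion)
  show ?thesis
  proof (cases "p = Quat (qre p) 0 0 0")
    case True
    define c where "c = qre p"
    have c: "c * c = 1"
      using p by (subst (asm) True) (simp add: qnorm_def c_def power2_eq_square)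
    obtain h where h: "\<And>e. F (Quat c e (\<i> * e) 0) = poly h e"
      using poly[OF c] by (auto simp: fun_eq_iff)
    have "poly h e = F (companion c)" if "e \<noteq> 0" for e
      unfolding h[symmetric] using that c
      by (subst nonscalar) (simp_all add: qnorm_def power2_eq_square algebra_simps)
    then have "UNIV - {0} \<subseteq> {e. poly (h - [:F (companion c):]) e = 0}"
      by auto
    moreover have "infinite (UNIV - {0 :: complex})"
      by (simp add: infinite_UNIV_char_0)
    ultimately have "h = [:F (companion c):]"
      using poly_roots_finite[of "h - [:F (companion c):]"] finite_subset by fastforce
    then have "F (Quat c 0 0 0) = F (companion c)"
      using h[of 0] by simp
    then show ?thesis
      by (metis True c_def)
  qed (use nonscalar p in blast)
qed

lemma rot_conjugate:
  "rot g h * rot p r * (rot g h)\<^sup>T = rot (g * p * qconj g) (h * r * qconj h)"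
  by (simp add: rot_transpose rot_mult)

text \<open>
  Evaluating on pairs of companions gives a polynomial \<open>P\<close> in the two real parts, and conjugation
  in each factor separately reduces every pair of unit quaternions to this case. Because \<open>(p, r)\<close>
  and \<open>(- p, - r)\<close> define the same rotation, \<open>P\<close> is even and its odd part vanishes.
\<close>

proposition regular_class_function_rot:
  assumes f: "f \<in> regular_functions_SO 4"
    and invariant: "\<And>g A. g \<in> carrier (SO 4) \<Longrightarrow> A \<in> carrier (SO 4) \<Longrightarrow> f (g * A * g\<^sup>T) = f A"
  obtains E where "E \<in> even_functions"
    "\<And>p r. qnorm p = 1 \<Longrightarrow> qnorm r = 1 \<Longrightarrow> f (rot p r) = E (qre p, qre r)"
proof -
  define P where "P = (\<lambda>z. f (rot (companion (fst z)) (companion (snd z))))"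
  have conj: "f (rot (g * p * qconj g) (h * r * qconj h)) = f (rot p r)"
    if "qnorm g = 1" "qnorm h = 1" "qnorm p = 1" "qnorm r = 1" for g h p r
    using invariant[of "rot g h" "rot p r"] that by (simp add: rot_conjugate rot_SO)
  have unipotent: "qnorm (Quat c e (\<i> * e) 0) = 1" if "c * c = 1" for c e
    using that by (simp add: qnorm_def power2_eq_square algebra_simps)
  note closed = function_algebra_UNIV[OF function_algebra_poly]
  have ident: "(\<lambda>e. e) \<in> range (poly :: complex poly \<Rightarrow> _)"
    by (auto intro!: image_eqI[of _ _ "[:0, 1:]"])
  have coords: "quat_coords_in (range poly) (\<lambda>e. Quat c e (\<i> * e) 0)" for c
    unfolding quat_coords_in_def quat.sel by (intro conjI closed ident)
  have fP: "f (rot p r) = P (qre p, qre r)" if p: "qnorm p = 1" and r: "qnorm r = 1" for p r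
  proof -
    have "f (rot p r) = f (rot (companion (qre p)) r)"
    proof (rule class_function_companion[where F = "\<lambda>p. f (rot p r)"])
      show "f (rot (g * p * qconj g) r) = f (rot p r)" if "qnorm g = 1" "qnorm p = 1" for g p
        using conj[of g 1 p r] that r by simp
      show "(\<lambda>e. f (rot (Quat c e (\<i> * e) 0) r)) \<in> range poly" if "c * c = 1" for c
        by (intro regular_function_rot f function_algebra_poly coords quat_coords_in_const)
          (simp_all add: unipotent that r)
    qed (rule p)
    also have "\<dots> = f (rot (companion (qre p)) (companion (qre r)))"
    proof (rule class_function_companion[where F = "\<lambda>r. f (rot (companion (qre p)) r)"])
      show "f (rot (companion (qre p)) (g * r * qconj g)) = f (rot (companion (qre p)) r)"
        if "qnorm g = 1" "qnorm r = 1" for g r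
        using conj[of 1 g "companion (qre p)" r] that by simp
      show "(\<lambda>e. f (rot (companion (qre p)) (Quat c e (\<i> * e) 0))) \<in> range poly" if "c * c = 1" for c
        by (intro regular_function_rot f function_algebra_poly coords quat_coords_in_const)
          (simp_all add: unipotent that)
    qed (rule r)
    finally show ?thesis by (simp add: P_def)
  qed
  have even: "P (- u, - v) = P (u, v)" for u v
    using fP[of "- companion u" "- companion v"] fP[of "companion u" "companion v"]
    by (simp add: rot_minus)
  let ?A = "generated_algebra UNIV {fst, snd :: complex \<times> complex \<Rightarrow> complex}"
  have A: "function_algebra UNIV ?A"
    by (rule function_algebra_generated)
  have "fst \<in> ?A" "snd \<in> ?A"
    using generated_algebra_generator[of _ "{fst, snd}" "UNIV :: (complex \<times> complex) set"]
    by (simp_all add: restrict_UNIV)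
  then have "P \<in> ?A"
    unfolding P_def
    by (intro regular_function_rot f A)
      (simp_all add: quat_coords_in_def companion_def[abs_def] qnorm_companion[unfolded companion_def]
         function_algebra_UNIV[OF A])
  then obtain E E1 E2 where E: "E \<in> even_functions" "E1 \<in> even_functions" "E2 \<in> even_functions"
    and P: "\<And>z. P z = E z + fst z * E1 z + snd z * E2 z"
    by (rule polynomial_even_odd) blast
  have "P (u, v) = E (u, v)" for u v
  proof -
    have "2 * (u * E1 (u, v) + v * E2 (u, v)) = 0"
      using even[of u v] P[of "(u, v)"] P[of "(- u, - v)"] E[THEN even_functions_minus, of u v]
      by (simp add: algebra_simps)
    then have "u * E1 (u, v) + v * E2 (u, v) = 0"
      by (metis mult_eq_0_iff zero_neq_numeral)
    then show ?thesis
      using P[of "(u, v)"] by (simp add: add.assoc)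
  qed
  then show ?thesis
    using that[OF E(1)] fP by simp
qed

section \<open>Curves of quaternion representations of a free group\<close>

definition letter_quat :: "('b \<Rightarrow> quat) \<Rightarrow> 'b \<times> bool \<Rightarrow> quat" where
  "letter_quat a x = (if snd x then a (fst x) else qconj (a (fst x)))"

text \<open>
  The image of a word in the free group under the homomorphism that sends the generator \<open>b\<close> to the
  unit quaternion \<open>a b\<close>.
\<close>

definition word_quat :: "('b \<Rightarrow> quat) \<Rightarrow> ('b \<times> bool) list \<Rightarrow> quat" where
  "word_quat a w = prod_list (map (letter_quat a) w)"

lemma qnorm_letter: "(\<And>b. qnorm (a b) = 1) \<Longrightarrow> qnorm (letter_quat a x) = 1"
  by (simp add: letter_quat_def)

lemma qnorm_word: "(\<And>b. qnorm (a b) = 1) \<Longrightarrow> qnorm (word_quat a w) = 1"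
  by (induction w) (simp_all add: word_quat_def qnorm_mult qnorm_letter)

lemma word_quat_prepend:
  assumes "\<And>b. qnorm (a b) = 1"
  shows "word_quat a (prepend_letter x w) = letter_quat a x * word_quat a w"
proof (cases w)
  case (Cons y v)
  have "letter_quat a x * letter_quat a y = 1" if "inverse_letters x y"
    using that by (cases "snd x")
      (auto simp: inverse_letters_def letter_quat_def unit_mult_qconj unit_qconj_mult assms)
  then have "letter_quat a x * (letter_quat a y * q) = q" if "inverse_letters x y" for q
    using that by (simp flip: mult.assoc)
  then show ?thesis by (simp add: Cons word_quat_def)
qed (simp add: word_quat_def)

lemma word_quat_mult:
  assumes "\<And>b. qnorm (a b) = 1"
  shows "word_quat a (foldr prepend_letter u v) = word_quat a u * word_quat a v"
  by (induction u) (simp_all add: word_quat_prepend[OF assms], simp_all add: word_quat_def mult.assoc)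

lemma word_quat_coords:
  assumes A: "function_algebra UNIV A" and a: "\<And>b. quat_coords_in A (\<lambda>y. a y b)"
  shows "quat_coords_in A (\<lambda>y. word_quat (a y) w)"
proof (induction w)
  case Nil
  then show ?case by (simp add: word_quat_def quat_coords_in_const[OF A])
next
  case (Cons x w)
  have "quat_coords_in A (\<lambda>y. letter_quat (a y) x)"
    by (cases "snd x") (simp_all add: letter_quat_def a quat_coords_in_conj[OF A])
  with Cons show ?case
    by (simp add: word_quat_def quat_coords_in_mult[OF A])
qed

text \<open>
  Conjugation by \<open>g\<close> is an automorphism, and the signs \<open>d b\<close> are central, so they can be collected
  in front of the word.
\<close>

lemma word_quat_twisted_conjugate:
  assumes g: "qnorm g = 1" and a': "\<And>b. a' b = d b * (g * a b * qconj g)"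
    and d: "\<And>b. d b = 1 \<or> d b = -1"
  shows "word_quat a' w = word_quat d w * (g * word_quat a w * qconj g) \<and>
    (word_quat d w = 1 \<or> word_quat d w = -1)"
proof (induction w)
  case Nil
  then show ?case by (simp add: word_quat_def unit_mult_qconj g)
next
  case (Cons x w)
  have letter: "letter_quat a' x = letter_quat d x * (g * letter_quat a x * qconj g)"
    using d[of "fst x"] by (auto simp: letter_quat_def a' qconj_mult mult.assoc)
  have pm: "letter_quat d x = 1 \<or> letter_quat d x = -1"
    using d[of "fst x"] by (auto simp: letter_quat_def)
  have "g * p * qconj g * (g * q * qconj g) = g * (p * q) * qconj g" for p q
    by (metis g mult.assoc mult.right_neutral unit_qconj_mult)
  with Cons letter pm show ?case
    by (auto simp: word_quat_def)
qed

definition has_parity :: "complex poly \<Rightarrow> bool" where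
  "has_parity p \<longleftrightarrow> (\<forall>n. even n \<longrightarrow> coeff p n = 0) \<or> (\<forall>n. odd n \<longrightarrow> coeff p n = 0)"

text \<open>
  Comparing coefficients in \<open>p (- s) = d * p s\<close> kills those of the wrong parity.
\<close>

lemma has_parityI:
  assumes "d = 1 \<or> d = -1" "\<And>s. poly p (- s) = d * poly p s"
  shows "has_parity p"
proof -
  have "poly (pcompose p [:0, -1:]) = poly (smult d p)"
    using assms(2) by (auto simp: poly_pcompose)
  then have "pcompose p [:0, -1:] = smult d p"
    by (rule poly_eq_poly_eq_iff[THEN iffD1])
  then have eq: "(-1) ^ n * coeff p n = d * coeff p n" for n
    using coeff_pcompose_linear[of p "-1" n] by (metis coeff_smult)
  from assms(1) show ?thesis
  proof
    assume "d = 1"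
    then have "coeff p n = 0" if "odd n" for n
      using eq[of n] that by simp
    then show ?thesis by (simp add: has_parity_def)
  next
    assume "d = -1"
    then have "coeff p n = 0" if "even n" for n
      using eq[of n] that by simp
    then show ?thesis by (simp add: has_parity_def)
  qed
qed

text \<open>
  If changing the sign of \<open>s\<close> amounts to a conjugation together with changes of sign of the
  generators, then by invariance of the real part under conjugation it changes the real part of
  every word by a sign that depends on the word alone.
\<close>

lemma parity_of_curve:
  fixes a :: "complex \<Rightarrow> 'b \<Rightarrow> quat"
  assumes coords: "\<And>b. quat_coords_in (range poly) (\<lambda>s. a s b)"
    and g: "qnorm g = 1" and reflect: "\<And>s b. a (- s) b = d b * (g * a s b * qconj g)"
    and d: "\<And>b. d b = 1 \<or> d b = -1"
  obtains u where "has_parity u" "\<And>s. qre (word_quat (a s) w) = poly u s"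
proof -
  have "(\<lambda>s. qre (word_quat (a s) w)) \<in> range poly"
    using word_quat_coords[of "range poly" a w, OF function_algebra_poly coords] by (simp add: quat_coords_in_def)
  then obtain u where u: "\<And>s. qre (word_quat (a s) w) = poly u s"
    by (auto simp: fun_eq_iff)
  have w: "word_quat (a (- s)) w = word_quat d w * (g * word_quat (a s) w * qconj g)"
    and pm: "word_quat d w = 1 \<or> word_quat d w = -1" for s
    using word_quat_twisted_conjugate[OF g, of "a (- s)" d "a s" w] reflect d by blast+
  have reflect_u: "poly u (- s) = qre (word_quat d w * (g * word_quat (a s) w * qconj g))" for s
    by (simp only: w flip: u)
  have "has_parity u"
    using pm
  proof
    assume "word_quat d w = 1"
    then show ?thesis
      using reflect_u by (intro has_parityI[of 1]) (simp_all add: qre_conjugate[OF g] u)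
  next
    assume "word_quat d w = -1"
    then show ?thesis
      using reflect_u by (intro has_parityI[of "-1"]) (simp_all add: qre_conjugate[OF g] u)
  qed
  with u that show ?thesis by blast
qed

section \<open>Third order jets along a pair of curves\<close>

text \<open>
  The vanishing linear coefficients and the equal constant ones make equality of the cubic
  coefficients stable under products: the mixed terms of degrees one and two drop out.
\<close>

definition matching_jets :: "complex poly \<Rightarrow> complex poly \<Rightarrow> bool" where
  "matching_jets F G \<longleftrightarrow> coeff F 1 = 0 \<and> coeff G 1 = 0 \<and> coeff F 0 = coeff G 0 \<and> coeff F 3 = coeff G 3"

lemma coeff_mult_small:
  fixes F G :: "complex poly"
  shows "coeff (F * G) 0 = coeff F 0 * coeff G 0"
    and "coeff (F * G) 1 = coeff F 0 * coeff G 1 + coeff F 1 * coeff G 0"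
    and "coeff (F * G) 3 = coeff F 0 * coeff G 3 + coeff F 1 * coeff G 2
      + coeff F 2 * coeff G 1 + coeff F 3 * coeff G 0"
  by (simp_all add: coeff_mult numeral_eq_Suc)

lemma matching_jets_mult:
  "matching_jets F G \<Longrightarrow> matching_jets F' G' \<Longrightarrow> matching_jets (F * F') (G * G')"
  by (simp add: matching_jets_def coeff_mult_small del: One_nat_def)

text \<open>
  Functions that are polynomial along the two curves \<open>\<rho>\<close> and \<open>\<sigma>\<close> and not told apart there by
  their third order jets, up to the quadratic terms.
\<close>

definition jet_algebra :: "'x set \<Rightarrow> (complex \<Rightarrow> 'x) \<Rightarrow> (complex \<Rightarrow> 'x) \<Rightarrow> ('x \<Rightarrow> complex) set" where
  "jet_algebra X \<rho> \<sigma> = {f \<in> X \<rightarrow>\<^sub>E UNIV. \<exists>F G. matching_jets F G \<and>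
     (\<forall>s. f (\<rho> s) = poly F s) \<and> (\<forall>s. f (\<sigma> s) = poly G s)}"

lemma function_algebra_jet:
  assumes "\<And>s. \<rho> s \<in> X" "\<And>s. \<sigma> s \<in> X"
  shows "function_algebra X (jet_algebra X \<rho> \<sigma>)"
  unfolding function_algebra_def
proof (intro conjI allI ballI)
  show "jet_algebra X \<rho> \<sigma> \<subseteq> X \<rightarrow>\<^sub>E UNIV"
    by (auto simp: jet_algebra_def)
  fix c show "(\<lambda>x\<in>X. c) \<in> jet_algebra X \<rho> \<sigma>"
    unfolding jet_algebra_def
    by (auto simp: assms matching_jets_def intro!: exI[of _ "[:c:]"])
next
  fix f g assume "f \<in> jet_algebra X \<rho> \<sigma>" "g \<in> jet_algebra X \<rho> \<sigma>"
  then obtain F G F' G' where "matching_jets F G" "matching_jets F' G'"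
    "\<And>s. f (\<rho> s) = poly F s" "\<And>s. f (\<sigma> s) = poly G s"
    "\<And>s. g (\<rho> s) = poly F' s" "\<And>s. g (\<sigma> s) = poly G' s"
    by (auto simp: jet_algebra_def)
  moreover from this have "matching_jets (F + F') (G + G')" "matching_jets (F * F') (G * G')"
    by (simp_all add: matching_jets_mult) (simp add: matching_jets_def)
  ultimately show "(\<lambda>x\<in>X. f x + g x) \<in> jet_algebra X \<rho> \<sigma>" "(\<lambda>x\<in>X. f x * g x) \<in> jet_algebra X \<rho> \<sigma>"
    unfolding jet_algebra_def
    by (simp_all add: assms)
      (rule exI[of _ "F + F'"], rule exI[of _ "G + G'"], simp,
       rule exI[of _ "F * F'"], rule exI[of _ "G * G'"], simp)
qed

text \<open>
  It suffices to look at \<open>u\<^sup>2\<close>, \<open>u * v\<close> and \<open>v\<^sup>2\<close>. The squares are even in \<open>s\<close>, so they have no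
  linear or cubic coefficient, and they have the same constant one. The product \<open>u * v\<close> takes the
  same values on both curves. Its linear coefficient vanishes: for equal parities because it is
  even, and for opposite parities because the common value at \<open>s = 0\<close> must be zero.
\<close>

lemma even_function_matching_jets:
  assumes E: "E \<in> even_functions" and parity: "has_parity u" "has_parity v"
    and "coeff u 0 = coeff v 0"
  obtains F G where "matching_jets F G"
    "\<And>s. E (poly u s, poly v s) = poly F s" "\<And>s. E (poly v s, poly u s) = poly G s"
proof -
  define \<rho> where "\<rho> s = (poly u s, poly v s)" for s
  define \<sigma> where "\<sigma> s = (poly v s, poly u s)" for s
  have "matching_jets (u * u) (v * v)" "matching_jets (v * v) (u * u)" "matching_jets (u * v) (u * v)"
  proof -
    have low: "(coeff p 1 = 0 \<and> coeff p 3 = 0) \<or> (coeff p 0 = 0 \<and> coeff p 2 = 0)"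
      if "has_parity p" for p
      using that unfolding has_parity_def by (metis even_numeral odd_numeral even_zero odd_one)
    show "matching_jets (u * u) (v * v)" "matching_jets (v * v) (u * u)" "matching_jets (u * v) (u * v)"
      using low[OF parity(1)] low[OF parity(2)] assms(4)
      by (elim disjE; simp add: matching_jets_def coeff_mult_small del: One_nat_def)+
  qed
  then have gens: "(\<lambda>z. fst z * fst z) \<in> jet_algebra UNIV \<rho> \<sigma>"
    "(\<lambda>z. fst z * snd z) \<in> jet_algebra UNIV \<rho> \<sigma>" "(\<lambda>z. snd z * snd z) \<in> jet_algebra UNIV \<rho> \<sigma>"
    unfolding jet_algebra_def \<rho>_def \<sigma>_def mem_Collect_eq
    by - (rule conjI, simp, rule exI[of _ "u * u"], rule exI[of _ "v * v"], simp,
      rule conjI, simp, rule exI[of _ "u * v"], rule exI[of _ "u * v"], simp,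
      rule conjI, simp, rule exI[of _ "v * v"], rule exI[of _ "u * u"], simp)
  have "even_functions \<subseteq> jet_algebra UNIV \<rho> \<sigma>"
    unfolding even_functions_def
    by (intro generated_algebra_minimal function_algebra_jet) (auto simp: restrict_UNIV gens)
  with E that show ?thesis
    by (auto simp: jet_algebra_def \<rho>_def \<sigma>_def)
qed

section \<open>Traces and the Pfaffian as invariants\<close>

lemma SO_carrier: "A \<in> carrier (SO n) \<longleftrightarrow> A \<in> carrier_mat n n \<and> A * A\<^sup>T = 1\<^sub>m n \<and> det A = 1"
  by (simp add: SO_def matrix_group_def)

lemma SO_mult: "A \<otimes>\<^bsub>SO n\<^esub> B = A * B"
  and SO_one: "\<one>\<^bsub>SO n\<^esub> = 1\<^sub>m n"
  by (simp_all add: SO_def matrix_group_def)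

lemma SO_mult_closed: "A \<in> carrier (SO n) \<Longrightarrow> B \<in> carrier (SO n) \<Longrightarrow> A * B \<in> carrier (SO n)"
  using monoid.m_closed[OF group.is_monoid[OF group_SO]] by (simp add: SO_mult)

lemma SO_transpose_mult: "A \<in> carrier (SO n) \<Longrightarrow> A\<^sup>T * A = 1\<^sub>m n"
  using mat_mult_left_right_inverse[of A n "A\<^sup>T"] by (simp add: SO_carrier)

lemma SO_transpose: "A \<in> carrier (SO n) \<Longrightarrow> A\<^sup>T \<in> carrier (SO n)"
  using SO_transpose_mult[of A n] by (auto simp: SO_carrier det_transpose)

lemma SO_inv: "A \<in> carrier (SO n) \<Longrightarrow> inv\<^bsub>SO n\<^esub> A = A\<^sup>T"
  by (rule group.inv_equality[OF group_SO])
    (simp_all add: SO_transpose SO_mult SO_one SO_transpose_mult)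

lemma mat_trace_commute:
  assumes "A \<in> carrier_mat n n" "B \<in> carrier_mat n n"
  shows "mat_trace (A * B) = mat_trace (B * A)"
  using assms unfolding mat_trace_def
  by (simp add: scalar_prod_def atLeast0LessThan) (subst sum.swap, simp add: mult.commute)

text \<open>
  Traces of representations are class functions by cyclicity of the trace. The inverse of \<open>g\<close>
  is \<open>g\<^sup>T\<close>.
\<close>

lemma trace_class_function:
  assumes \<phi>: "algebraic_rep_SO m n \<phi>" and g: "g \<in> carrier (SO m)" and A: "A \<in> carrier (SO m)"
  shows "mat_trace (\<phi> (g * A * g\<^sup>T)) = mat_trace (\<phi> A)"
proof -
  have hom: "B \<in> carrier (SO m) \<Longrightarrow> C \<in> carrier (SO m) \<Longrightarrow> \<phi> (B * C) = \<phi> B * \<phi> C"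
    and dim: "B \<in> carrier (SO m) \<Longrightarrow> \<phi> B \<in> carrier_mat n n" for B C
    using \<phi> unfolding algebraic_rep_SO_def hom_def
    by (auto simp: GL_def matrix_group_def SO_mult)
  note closed = g A SO_transpose SO_mult_closed
  have carrier: "g \<in> carrier_mat m m" "A \<in> carrier_mat m m"
    using g A by (auto simp: SO_carrier)
  have "mat_trace (\<phi> (g * A * g\<^sup>T)) = mat_trace (\<phi> (g * A) * \<phi> (g\<^sup>T))"
    by (simp add: hom closed)
  also have "\<dots> = mat_trace (\<phi> (g\<^sup>T) * \<phi> (g * A))"
    by (rule mat_trace_commute[of _ n]) (simp_all add: dim closed)
  also have "\<dots> = mat_trace (\<phi> (g\<^sup>T * (g * A)))"
    by (simp add: hom closed)
  also have "g\<^sup>T * (g * A) = A"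
    using carrier SO_transpose_mult[OF g] assoc_mult_mat[of "g\<^sup>T" m m g m A m] by simp
  finally show ?thesis .
qed

lemma trace_regular:
  assumes "algebraic_rep_SO m n \<phi>"
  shows "(\<lambda>A\<in>carrier (SO m). mat_trace (\<phi> A)) \<in> regular_functions_SO m"
proof -
  have "(\<lambda>A\<in>carrier (SO m). \<Sum>i<n. \<phi> A $$ (i, i)) \<in> regular_functions_SO m"
    using assms unfolding regular_functions_SO_def
    by (intro function_algebra_sum function_algebra_generated)
      (auto simp: algebraic_rep_SO_def regular_functions_SO_def)
  also have "(\<lambda>A\<in>carrier (SO m). \<Sum>i<n. \<phi> A $$ (i, i)) = (\<lambda>A\<in>carrier (SO m). mat_trace (\<phi> A))"
  proof (rule restrict_ext)
    fix A assume "A \<in> carrier (SO m)"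
    then have "\<phi> A \<in> carrier_mat n n"
      using assms unfolding algebraic_rep_SO_def hom_def by (auto simp: GL_def matrix_group_def)
    then show "(\<Sum>i<n. \<phi> A $$ (i, i)) = mat_trace (\<phi> A)"
      by (simp add: mat_trace_def)
  qed
  finally show ?thesis .
qed

lemma Hom_SO_carrier: "\<rho> \<in> Hom_SO m \<Gamma> \<Longrightarrow> \<gamma> \<in> carrier \<Gamma> \<Longrightarrow> \<rho> \<gamma> \<in> carrier (SO m)"
  by (auto simp: Hom_SO_def hom_def)

lemma Hom_SO_mult:
  "\<rho> \<in> Hom_SO m \<Gamma> \<Longrightarrow> \<gamma> \<in> carrier \<Gamma> \<Longrightarrow> \<delta> \<in> carrier \<Gamma> \<Longrightarrow> \<rho> (\<gamma> \<otimes>\<^bsub>\<Gamma>\<^esub> \<delta>) = \<rho> \<gamma> * \<rho> \<delta>"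
  by (auto simp: Hom_SO_def hom_def SO_mult)

lemma Hom_SO_group_hom: "group \<Gamma> \<Longrightarrow> \<rho> \<in> Hom_SO m \<Gamma> \<Longrightarrow> group_hom \<Gamma> (SO m) \<rho>"
  by (simp add: group_hom_def group_hom_axioms_def group_SO Hom_SO_def)

lemma conj_rep_apply:
  assumes "g \<in> carrier (SO m)" "\<gamma> \<in> carrier \<Gamma>"
  shows "conj_rep m \<Gamma> g \<rho> \<gamma> = g * \<rho> \<gamma> * g\<^sup>T"
  using assms by (simp add: conj_rep_def SO_mult SO_inv)

lemma conj_rep_Hom:
  assumes "group \<Gamma>" "g \<in> carrier (SO m)" "\<rho> \<in> Hom_SO m \<Gamma>"
  shows "conj_rep m \<Gamma> g \<rho> \<in> Hom_SO m \<Gamma>"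
proof -
  interpret \<Gamma>: group \<Gamma> by fact
  have "g * (A * B) * g\<^sup>T = g * A * g\<^sup>T * (g * B * g\<^sup>T)"
    if "A \<in> carrier (SO m)" "B \<in> carrier (SO m)" for A B
  proof -
    interpret S: group "SO m" by (rule group_SO)
    have "inv\<^bsub>SO m\<^esub> g \<otimes>\<^bsub>SO m\<^esub> (g \<otimes>\<^bsub>SO m\<^esub> C) = C" if "C \<in> carrier (SO m)" for C
      using that assms(2) S.m_assoc[of "inv\<^bsub>SO m\<^esub> g" g C] by simp
    then have "g \<otimes>\<^bsub>SO m\<^esub> (A \<otimes>\<^bsub>SO m\<^esub> B) \<otimes>\<^bsub>SO m\<^esub> inv\<^bsub>SO m\<^esub> g =
        g \<otimes>\<^bsub>SO m\<^esub> A \<otimes>\<^bsub>SO m\<^esub> inv\<^bsub>SO m\<^esub> g \<otimes>\<^bsub>SO m\<^esub> (g \<otimes>\<^bsub>SO m\<^esub> B \<otimes>\<^bsub>SO m\<^esub> inv\<^bsub>SO m\<^esub> g)"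
      using that assms(2) by (simp add: S.m_assoc)
    then show ?thesis
      by (simp add: SO_mult SO_inv assms(2))
  qed
  then have "conj_rep m \<Gamma> g \<rho> \<in> hom \<Gamma> (SO m)"
    using assms
    by (intro homI) (simp_all add: conj_rep_apply SO_mult_closed SO_transpose Hom_SO_carrier Hom_SO_mult SO_mult)
  then show ?thesis
    by (simp add: Hom_SO_def conj_rep_def)
qed

text \<open>
  The coordinate ring is generated by the entries at the elements of \<open>gs\<close>. Entries at a product are
  polynomials in those of the factors, and entries at an inverse are entries of the transpose.
\<close>

lemma evaluation_entry_regular:
  assumes \<Gamma>: "group \<Gamma>" and gs: "set gs \<subseteq> carrier \<Gamma>" "generate \<Gamma> (set gs) = carrier \<Gamma>"
    and \<gamma>: "\<gamma> \<in> carrier \<Gamma>" and ij: "i < m" "j < m"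
  shows "(\<lambda>\<rho>\<in>Hom_SO m \<Gamma>. \<rho> \<gamma> $$ (i, j)) \<in> coord_ring_Hom_SO m \<Gamma> gs"
proof -
  interpret \<Gamma>: group \<Gamma> by fact
  let ?A = "coord_ring_Hom_SO m \<Gamma> gs" and ?X = "Hom_SO m \<Gamma>"
  have A: "function_algebra ?X ?A"
    unfolding coord_ring_Hom_SO_def by (rule function_algebra_generated)
  have gen: "(\<lambda>\<rho>\<in>?X. \<rho> h $$ (i, j)) \<in> ?A" if "h \<in> set gs" "i < m" "j < m" for h i j
    unfolding coord_ring_Hom_SO_def by (rule generated_algebra_generator) (use that in auto)
  have "\<gamma> \<in> generate \<Gamma> (set gs)"
    using \<gamma> gs by simp
  then show ?thesis
    using ij
  proof (induction arbitrary: i j rule: generate.induct)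
    case one
    have "(\<lambda>\<rho>\<in>?X. \<rho> \<one>\<^bsub>\<Gamma>\<^esub> $$ (i, j)) = (\<lambda>\<rho>\<in>?X. 1\<^sub>m m $$ (i, j))"
      using group_hom.hom_one[OF Hom_SO_group_hom[OF \<Gamma>]] by (intro restrict_ext) (simp add: SO_one)
    then show ?case
      by (simp only: function_algebra_const[OF A])
  next
    case (incl h)
    then show ?case using gen by blast
  next
    case (inv h)
    have "(\<lambda>\<rho>\<in>?X. \<rho> (inv\<^bsub>\<Gamma>\<^esub> h) $$ (i, j)) = (\<lambda>\<rho>\<in>?X. \<rho> h $$ (j, i))"
    proof (rule restrict_ext)
      fix \<rho> assume \<rho>: "\<rho> \<in> ?X"
      have h: "h \<in> carrier \<Gamma>" using inv gs by auto
      have "\<rho> h \<in> carrier (SO m)" by (rule Hom_SO_carrier[OF \<rho> h])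
      moreover from this have "\<rho> h \<in> carrier_mat m m" by (simp add: SO_carrier)
      ultimately show "\<rho> (inv\<^bsub>\<Gamma>\<^esub> h) $$ (i, j) = \<rho> h $$ (j, i)"
        using group_hom.hom_inv[OF Hom_SO_group_hom[OF \<Gamma> \<rho>] h] inv.prems by (simp add: SO_inv)
    qed
    then show ?case using gen[OF inv.hyps inv.prems(2,1)] by (simp only:)
  next
    case (eng h1 h2)
    have carrier: "h1 \<in> carrier \<Gamma>" "h2 \<in> carrier \<Gamma>"
      using eng.hyps gs by auto
    have "(\<lambda>\<rho>\<in>?X. \<Sum>k<m. \<rho> h1 $$ (i, k) * \<rho> h2 $$ (k, j)) \<in> ?A"
    proof (rule function_algebra_sum[OF A])
      fix k assume "k \<in> {..<m}"
      with eng.prems show "(\<lambda>\<rho>\<in>?X. \<rho> h1 $$ (i, k) * \<rho> h2 $$ (k, j)) \<in> ?A"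
        by (intro function_algebra_mult_restrict[OF A] eng.IH) simp_all
    qed simp
    also have "(\<lambda>\<rho>\<in>?X. \<Sum>k<m. \<rho> h1 $$ (i, k) * \<rho> h2 $$ (k, j)) =
        (\<lambda>\<rho>\<in>?X. \<rho> (h1 \<otimes>\<^bsub>\<Gamma>\<^esub> h2) $$ (i, j))"
    proof (rule restrict_ext)
      fix \<rho> assume \<rho>: "\<rho> \<in> ?X"
      have "\<rho> h1 \<in> carrier_mat m m" "\<rho> h2 \<in> carrier_mat m m"
        using Hom_SO_carrier[OF \<rho>] carrier by (auto simp: SO_carrier)
      then show "(\<Sum>k<m. \<rho> h1 $$ (i, k) * \<rho> h2 $$ (k, j)) = \<rho> (h1 \<otimes>\<^bsub>\<Gamma>\<^esub> h2) $$ (i, j)"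
        using eng.prems by (simp add: Hom_SO_mult[OF \<rho> carrier] scalar_prod_def atLeast0LessThan)
    qed
    finally show ?case .
  qed
qed

lemma function_algebra_invariants:
  assumes "group \<Gamma>"
  shows "function_algebra (Hom_SO m \<Gamma>) (coord_ring_X_SO m \<Gamma> gs)"
proof -
  have "function_algebra (Hom_SO m \<Gamma>) (coord_ring_Hom_SO m \<Gamma> gs)"
    unfolding coord_ring_Hom_SO_def by (rule function_algebra_generated)
  then show ?thesis
    using conj_rep_Hom[OF assms]
    unfolding function_algebra_def coord_ring_X_SO_def by auto
qed

lemma full_trace_algebra_invariant:
  assumes \<Gamma>: "group \<Gamma>" and gs: "set gs \<subseteq> carrier \<Gamma>" "generate \<Gamma> (set gs) = carrier \<Gamma>"
  shows "full_trace_algebra_SO m \<Gamma> \<subseteq> coord_ring_X_SO m \<Gamma> gs"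
  unfolding full_trace_algebra_SO_def
proof (rule generated_algebra_minimal[OF function_algebra_invariants[OF \<Gamma>]])
  let ?X = "Hom_SO m \<Gamma>"
  fix f assume "f \<in> {\<lambda>\<rho>. mat_trace (\<phi> (\<rho> \<gamma>)) | \<phi> \<gamma>. \<gamma> \<in> carrier \<Gamma> \<and> (\<exists>n. algebraic_rep_SO m n \<phi>)}"
  then obtain \<phi> \<gamma> n where f: "f = (\<lambda>\<rho>. mat_trace (\<phi> (\<rho> \<gamma>)))" and \<gamma>: "\<gamma> \<in> carrier \<Gamma>"
    and \<phi>: "algebraic_rep_SO m n \<phi>" by blast
  have "(\<lambda>\<rho>\<in>?X. (\<lambda>A\<in>carrier (SO m). mat_trace (\<phi> A)) (\<rho> \<gamma>)) \<in> coord_ring_Hom_SO m \<Gamma> gs"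
    by (rule generated_algebra_pullback[OF _ _ _ trace_regular[OF \<phi>, unfolded regular_functions_SO_def]])
      (auto simp: coord_ring_Hom_SO_def function_algebra_generated Hom_SO_carrier[OF _ \<gamma>]
        intro!: evaluation_entry_regular[OF \<Gamma> gs \<gamma>, unfolded coord_ring_Hom_SO_def])
  moreover have "(\<lambda>\<rho>\<in>?X. (\<lambda>A\<in>carrier (SO m). mat_trace (\<phi> A)) (\<rho> \<gamma>)) = restrict f ?X"
    unfolding f by (rule restrict_ext) (simp add: Hom_SO_carrier[OF _ \<gamma>])
  ultimately show "restrict f ?X \<in> coord_ring_X_SO m \<Gamma> gs"
    by (simp add: coord_ring_X_SO_def conj_rep_Hom[OF \<Gamma>] f conj_rep_apply[OF _ \<gamma>]
        trace_class_function[OF \<phi>] Hom_SO_carrier[OF _ \<gamma>])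
qed

text \<open>
  The polarised Pfaffian is invariant under conjugation by orthogonal matrices of determinant
  one, while orthogonal matrices of determinant \<open>- 1\<close> change its sign. One of these is the matrix of
  \<open>qconj\<close>, and conjugation by it exchanges the two factors of a pair of quaternions.
\<close>

lemma polar_pfaffian_invariant:
  assumes \<Gamma>: "group \<Gamma>" and gs: "set gs \<subseteq> carrier \<Gamma>" "generate \<Gamma> (set gs) = carrier \<Gamma>"
    and \<alpha>: "\<alpha> \<in> carrier \<Gamma>" and \<beta>: "\<beta> \<in> carrier \<Gamma>"
  shows "(\<lambda>\<rho>\<in>Hom_SO 4 \<Gamma>. polar_pfaffian (\<rho> \<alpha>) (\<rho> \<beta>)) \<in> coord_ring_X_SO 4 \<Gamma> gs"
proof -
  let ?X = "Hom_SO 4 \<Gamma>"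
  have A: "function_algebra ?X (coord_ring_Hom_SO 4 \<Gamma> gs)"
    unfolding coord_ring_Hom_SO_def by (rule function_algebra_generated)
  have lt: "p i < 4" if "p permutes {0..<4::nat}" "i < 4" for p i
    using permutes_in_image[OF that(1), of i] that(2) by simp
  have "(\<lambda>\<rho>\<in>?X. \<Sum>p | p permutes {0..<4}. signof p *
      (\<rho> \<alpha> $$ (p 0, p 1) * \<rho> \<beta> $$ (p 2, p 3))) \<in> coord_ring_Hom_SO 4 \<Gamma> gs"
    by (intro function_algebra_sum[OF A] function_algebra_mult_restrict[OF A] function_algebra_const[OF A]
        evaluation_entry_regular[OF \<Gamma> gs] \<alpha> \<beta> finite_permutations) (auto intro: lt)
  then have "(\<lambda>\<rho>\<in>?X. polar_pfaffian (\<rho> \<alpha>) (\<rho> \<beta>)) \<in> coord_ring_Hom_SO 4 \<Gamma> gs"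
    unfolding polar_pfaffian_def alternating_sum_permutations .
  moreover have "polar_pfaffian (g * \<rho> \<alpha> * g\<^sup>T) (g * \<rho> \<beta> * g\<^sup>T) = polar_pfaffian (\<rho> \<alpha>) (\<rho> \<beta>)"
    if "g \<in> carrier (SO 4)" "\<rho> \<in> ?X" for g \<rho>
  proof -
    have "g \<in> carrier_mat 4 4" "det g = 1" "\<rho> \<alpha> \<in> carrier_mat 4 4" "\<rho> \<beta> \<in> carrier_mat 4 4"
      using that(1) Hom_SO_carrier[OF that(2) \<alpha>] Hom_SO_carrier[OF that(2) \<beta>]
      by (simp_all add: SO_carrier)
    then show ?thesis
      by (metis polar_pfaffian_conjugate mult_1)
  qed
  ultimately show ?thesis
    by (simp add: coord_ring_X_SO_def conj_rep_Hom[OF \<Gamma>] conj_rep_apply \<alpha> \<beta>)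
qed

section \<open>Separating the Pfaffian from the traces\<close>

lemma corank_epimorphism:
  assumes "group \<Gamma>" "corank_at_least_two \<Gamma>"
  obtains \<psi> where "\<psi> \<in> hom \<Gamma> (free_group {0, 1 :: nat})"
    "\<psi> ` carrier \<Gamma> = carrier (free_group {0, 1 :: nat})"
proof -
  obtain N h where N: "N \<lhd> \<Gamma>" and h: "h \<in> iso (\<Gamma> Mod N) (free_group {0, 1 :: nat})"
    using assms(2) unfolding corank_at_least_two_def is_iso_def by auto
  have "h \<circ> (\<lambda>a. N #>\<^bsub>\<Gamma>\<^esub> a) \<in> hom \<Gamma> (free_group {0, 1})"
    using hom_compose[OF normal.r_coset_hom_Mod[OF N]] h by (auto simp: iso_def)
  moreover have "(\<lambda>a. N #>\<^bsub>\<Gamma>\<^esub> a) ` carrier \<Gamma> = carrier (\<Gamma> Mod N)"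
    by (auto simp: FactGroup_def RCOSETS_def)
  then have "(h \<circ> (\<lambda>a. N #>\<^bsub>\<Gamma>\<^esub> a)) ` carrier \<Gamma> = carrier (free_group {0, 1})"
    using h by (simp add: iso_def bij_betw_def flip: image_image)
  ultimately show ?thesis by (rule that)
qed

text \<open>
  The representation in \<open>SO 4\<close> given by a homomorphism \<open>\<psi>\<close> to a free group and a unit quaternion
  in each of the two factors for every generator.
\<close>

definition quat_rep ::
    "('a, 'm) monoid_scheme \<Rightarrow> ('a \<Rightarrow> ('b \<times> bool) list) \<Rightarrow> ('b \<Rightarrow> quat) \<Rightarrow> ('b \<Rightarrow> quat) \<Rightarrow> 'a \<Rightarrow> complex mat" where
  "quat_rep \<Gamma> \<psi> a b = (\<lambda>\<gamma>\<in>carrier \<Gamma>. rot (word_quat a (\<psi> \<gamma>)) (word_quat b (\<psi> \<gamma>)))"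

lemma quat_rep_Hom:
  assumes "group \<Gamma>" "\<psi> \<in> hom \<Gamma> (free_group B)" "\<And>n. qnorm (a n) = 1" "\<And>n. qnorm (b n) = 1"
  shows "quat_rep \<Gamma> \<psi> a b \<in> Hom_SO 4 \<Gamma>"
proof -
  interpret \<Gamma>: group \<Gamma> by fact
  have "\<psi> (\<gamma> \<otimes>\<^bsub>\<Gamma>\<^esub> \<delta>) = foldr prepend_letter (\<psi> \<gamma>) (\<psi> \<delta>)"
    if "\<gamma> \<in> carrier \<Gamma>" "\<delta> \<in> carrier \<Gamma>" for \<gamma> \<delta>
    using hom_mult[OF assms(2) that] by (simp add: free_group_def)
  then have "quat_rep \<Gamma> \<psi> a b \<in> hom \<Gamma> (SO 4)"
    by (intro homI) (simp_all add: quat_rep_def rot_SO qnorm_word assms SO_mult rot_mult word_quat_mult)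
  then show ?thesis by (simp add: Hom_SO_def quat_rep_def)
qed

text \<open>
  The real parts at the two generators and at their product are \<open>(s, s, 0)\<close> for \<open>left_curve\<close> and
  \<open>(0, 0, - s)\<close> for \<open>right_curve\<close>. The multiples of \<open>\<i>\<close> in the last coordinate keep the norms
  equal to one while all coordinates stay polynomial in \<open>s\<close>. At \<open>s = 0\<close> the two curves meet, in the
  quaternion units \<open>j\<close> and \<open>i\<close>. Generators are numbered by natural numbers, and every number other
  than \<open>0\<close> is treated like \<open>1\<close>.
\<close>

definition left_curve :: "complex \<Rightarrow> nat \<Rightarrow> quat" where
  "left_curve s n = (if n = 0 then Quat s 0 1 (\<i> * s) else Quat s 1 0 (- (\<i> * s)))"

definition right_curve :: "complex \<Rightarrow> nat \<Rightarrow> quat" where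
  "right_curve s n = (if n = 0 then Quat 0 0 1 0 else Quat 0 1 s (\<i> * s))"

lemma qnorm_curves: "qnorm (left_curve s n) = 1" "qnorm (right_curve s n) = 1"
  by (simp_all add: left_curve_def right_curve_def qnorm_def power2_eq_square algebra_simps)

text \<open>
  Conjugation by \<open>k\<close> reverses \<open>i\<close> and \<open>j\<close>, conjugation by \<open>i\<close> reverses \<open>j\<close> and \<open>k\<close>. Combined with
  changes of sign of the generators, they realise \<open>s \<mapsto> - s\<close> on the two curves.
\<close>

lemma left_curve_reflect:
  "left_curve (- s) n = - 1 * (Quat 0 0 0 1 * left_curve s n * qconj (Quat 0 0 0 1))"
  by (simp add: left_curve_def quat_arith qconj_def)

lemma right_curve_reflect:
  "right_curve (- s) n = (if n = 0 then - 1 else 1) * (Quat 0 1 0 0 * right_curve s n * qconj (Quat 0 1 0 0))"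
  by (simp add: right_curve_def quat_arith qconj_def)

lemma curve_coords:
  "quat_coords_in (range poly) (\<lambda>s. left_curve s n)" "quat_coords_in (range poly) (\<lambda>s. right_curve s n)"
proof -
  note closed = function_algebra_UNIV[OF function_algebra_poly]
  have ident: "(\<lambda>s. s) \<in> range (poly :: complex poly \<Rightarrow> _)"
    by (auto intro!: image_eqI[of _ _ "[:0, 1:]"])
  show "quat_coords_in (range poly) (\<lambda>s. left_curve s n)" "quat_coords_in (range poly) (\<lambda>s. right_curve s n)"
    unfolding quat_coords_in_def left_curve_def right_curve_def
    by (cases "n = 0"; simp; intro conjI closed ident)+
qed

lemma class_function_on_curves:
  assumes f: "f \<in> regular_functions_SO 4"
    and invariant: "\<And>g A. g \<in> carrier (SO 4) \<Longrightarrow> A \<in> carrier (SO 4) \<Longrightarrow> f (g * A * g\<^sup>T) = f A"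
  obtains F G where "matching_jets F G"
    "\<And>s. f (rot (word_quat (left_curve s) w) (word_quat (right_curve s) w)) = poly F s"
    "\<And>s. f (rot (word_quat (right_curve s) w) (word_quat (left_curve s) w)) = poly G s"
proof -
  obtain E where E: "E \<in> even_functions"
    "\<And>p r. qnorm p = 1 \<Longrightarrow> qnorm r = 1 \<Longrightarrow> f (rot p r) = E (qre p, qre r)"
    by (rule regular_class_function_rot[OF f invariant]) blast+
  obtain u where u: "has_parity u" "\<And>s. qre (word_quat (left_curve s) w) = poly u s"
    by (rule parity_of_curve[where a = left_curve and w = w, OF curve_coords(1) _ left_curve_reflect]) (auto simp: qnorm_def)
  obtain v where v: "has_parity v" "\<And>s. qre (word_quat (right_curve s) w) = poly v s"
    by (rule parity_of_curve[where a = right_curve and w = w, OF curve_coords(2) _ right_curve_reflect]) (auto simp: qnorm_def)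
  \<comment> \<open>The curves start at the same point, so the real parts of a word agree at \<open>s = 0\<close>.\<close>
  have "left_curve 0 = right_curve 0"
    by (simp add: left_curve_def right_curve_def fun_eq_iff)
  then have "coeff u 0 = coeff v 0"
    using u(2)[of 0] v(2)[of 0] by (simp add: poly_0_coeff_0)
  then obtain F G where "matching_jets F G"
    "\<And>s. E (poly u s, poly v s) = poly F s" "\<And>s. E (poly v s, poly u s) = poly G s"
    using even_function_matching_jets[OF E(1) u(1) v(1)] by blast
  then show ?thesis
    by (intro that) (simp_all add: E(2) qnorm_word qnorm_curves u v)
qed

lemma polar_pfaffian_curves:
  "polar_pfaffian (rot (left_curve s 0) (right_curve s 0)) (rot (left_curve s 1) (right_curve s 1)) = - 8 * s ^ 3"
  "polar_pfaffian (rot (right_curve s 0) (left_curve s 0)) (rot (right_curve s 1) (left_curve s 1)) = 8 * s ^ 3"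
  unfolding polar_pfaffian_def alternating_sum_def
  by (simp_all add: qcoord_def qbasis_def quat_arith qconj_def left_curve_def right_curve_def,
     simp_all add: power3_eq_cube algebra_simps)

text \<open>
  All trace functions satisfy the conditions on jets along \<open>\<rho>\<close> and \<open>\<sigma>\<close>, hence so does the algebra
  that they generate. The Pfaffian at preimages of the two free generators is an invariant with
  cubic coefficients \<open>- 8\<close> and \<open>8\<close>.
\<close>

theorem corollary3:
  fixes \<Gamma> :: "'a monoid" and gs :: "'a list"
  assumes "group \<Gamma>"
    and "set gs \<subseteq> carrier \<Gamma>" and "generate \<Gamma> (set gs) = carrier \<Gamma>"
    and "corank_at_least_two \<Gamma>"
  shows "proper_subalgebra (Hom_SO 4 \<Gamma>) (full_trace_algebra_SO 4 \<Gamma>) (coord_ring_X_SO 4 \<Gamma> gs)"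
proof -
  let ?X = "Hom_SO 4 \<Gamma>"
  obtain \<psi> where \<psi>: "\<psi> \<in> hom \<Gamma> (free_group {0, 1 :: nat})"
    "\<psi> ` carrier \<Gamma> = carrier (free_group {0, 1 :: nat})"
    using corank_epimorphism[OF assms(1,4)] .
  have "[(0, True)] \<in> \<psi> ` carrier \<Gamma>" "[(1, True)] \<in> \<psi> ` carrier \<Gamma>"
    unfolding \<psi>(2) by (simp_all add: free_group_def reduced_word_def)
  then obtain \<alpha> \<beta> where \<alpha>: "\<alpha> \<in> carrier \<Gamma>" "\<psi> \<alpha> = [(0, True)]"
    and \<beta>: "\<beta> \<in> carrier \<Gamma>" "\<psi> \<beta> = [(1, True)]" by force
  define \<rho> where "\<rho> s = quat_rep \<Gamma> \<psi> (left_curve s) (right_curve s)" for s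
  define \<sigma> where "\<sigma> s = quat_rep \<Gamma> \<psi> (right_curve s) (left_curve s)" for s
  have X: "\<rho> s \<in> ?X" "\<sigma> s \<in> ?X" for s
    unfolding \<rho>_def \<sigma>_def by (rule quat_rep_Hom[OF assms(1) \<psi>(1)]; rule qnorm_curves)+
  have traces: "full_trace_algebra_SO 4 \<Gamma> \<subseteq> jet_algebra ?X \<rho> \<sigma>"
    unfolding full_trace_algebra_SO_def
  proof (rule generated_algebra_minimal[OF function_algebra_jet[OF X]])
    fix t assume "t \<in> {\<lambda>\<rho>. mat_trace (\<phi> (\<rho> \<gamma>)) | \<phi> \<gamma>. \<gamma> \<in> carrier \<Gamma> \<and> (\<exists>n. algebraic_rep_SO 4 n \<phi>)}"
    then obtain \<phi> \<gamma> n where t: "t = (\<lambda>\<rho>. mat_trace (\<phi> (\<rho> \<gamma>)))" and \<gamma>: "\<gamma> \<in> carrier \<Gamma>"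
      and \<phi>: "algebraic_rep_SO 4 n \<phi>" by blast
    define f where "f = (\<lambda>A\<in>carrier (SO 4). mat_trace (\<phi> A))"
    have "f (g * A * g\<^sup>T) = f A" if "g \<in> carrier (SO 4)" "A \<in> carrier (SO 4)" for g A
      using that by (simp add: f_def trace_class_function[OF \<phi>] SO_mult_closed SO_transpose)
    then obtain F G where jets: "matching_jets F G"
      "\<And>s. f (rot (word_quat (left_curve s) (\<psi> \<gamma>)) (word_quat (right_curve s) (\<psi> \<gamma>))) = poly F s"
      "\<And>s. f (rot (word_quat (right_curve s) (\<psi> \<gamma>)) (word_quat (left_curve s) (\<psi> \<gamma>))) = poly G s"
      using class_function_on_curves[OF trace_regular[OF \<phi>, folded f_def]] by blast
    have "t (\<rho> s) = poly F s" "t (\<sigma> s) = poly G s" for s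
      using jets(2,3)[of s]
      by (simp_all add: t f_def \<rho>_def \<sigma>_def quat_rep_def \<gamma> rot_SO qnorm_word qnorm_curves)
    with jets(1) show "restrict t ?X \<in> jet_algebra ?X \<rho> \<sigma>"
      unfolding jet_algebra_def using X by auto
  qed
  define Q where "Q = (\<lambda>\<rho>\<in>?X. polar_pfaffian (\<rho> \<alpha>) (\<rho> \<beta>))"
  have Q: "Q \<in> coord_ring_X_SO 4 \<Gamma> gs"
    unfolding Q_def by (intro polar_pfaffian_invariant assms(1-3) \<alpha> \<beta>)
  have "Q \<notin> jet_algebra ?X \<rho> \<sigma>"
  proof
    assume "Q \<in> jet_algebra ?X \<rho> \<sigma>"
    then obtain F G where jets: "matching_jets F G" "\<And>s. Q (\<rho> s) = poly F s" "\<And>s. Q (\<sigma> s) = poly G s"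
      by (auto simp: jet_algebra_def)
    have "Q (\<rho> s) = - 8 * s ^ 3" "Q (\<sigma> s) = 8 * s ^ 3" for s
      using polar_pfaffian_curves[of s] X
      by (simp_all add: Q_def) (simp_all add: \<rho>_def \<sigma>_def quat_rep_def \<alpha> \<beta> word_quat_def letter_quat_def)
    then have "poly F = poly (monom (- 8) 3)" "poly G = poly (monom 8 3)"
      using jets(2,3) by (auto simp: poly_monom fun_eq_iff)
    then have "F = monom (- 8) 3" "G = monom 8 3"
      by (simp_all only: poly_eq_poly_eq_iff)
    with jets(1) show False
      by (simp add: matching_jets_def)
  qed
  with traces Q have "full_trace_algebra_SO 4 \<Gamma> \<subset> coord_ring_X_SO 4 \<Gamma> gs"
    using full_trace_algebra_invariant[OF assms(1-3)] by blast
  then show ?thesis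
    unfolding proper_subalgebra_def full_trace_algebra_SO_def
    using function_algebra_generated function_algebra_invariants[OF assms(1)] by blast
qed

end
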